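(* Let $d\ge 1$ and let $0\le \delta\le s$ be integers with $s\ge 1$. Let $D_{2^s}\subset U^d=[0,1)^d$ be an arbitrary dyadic $(\delta,s,d)$-net. Then for each $0<q<\infty$, $$\mathcal M_{s,q}[D_{2^s}]<2^{-d+\delta+1}\left(\left\lceil \tfrac{1}{2}q\right\rceil (s+1)\right)^{\frac{1}{2}(d-1)}+d\,2^{\delta}.$$ In particular, there exist dyadic shifts $T\in \mathbb Q^d(2^s)$ such that $$\mathcal L_q[D_{2^s}\oplus T]\le 2^{-d+\delta+1}\left(\left\lceil \tfrac{1}{2}q\right\rceil (s+1)\right)^{\frac{1}{2}(d-1)}+d\,2^{\delta}.$$
   Context: For a finite set $D\subset U^d$ and $Y=(y_1,\dots,y_d)\in U^d$, let $B_Y=[0,y_1)\times\dots\times[0,y_d)$ and define the local discrepancy $\mathcal L[D,Y]=|D\cap B_Y|-|D|\,y_1\cdots y_d$ ($|\cdot|$ = cardinality). The $L_q$-discrepancy is $\mathcal L_q[D]=\left(\int_{U^d}|\mathcal L[D,Y]|^q\,dY\right)^{1/q}$ for $0<q<\infty$, and $\mathcal L_\infty[D]=\sup_{Y\in U^d}|\mathcal L[D,Y]|$. Every $y\in[0,1)$ has a unique dyadic expansion $y=\sum_{a\ge1}\eta_a(y)2^{-a}$ with $\eta_a(y)\in\{0,1\}$ and infinitely many $\eta_a(y)=0$. Let $\mathbb Q(2^s)=\{m2^{-s}:m=0,1,\dots,2^s-1\}$ and $\mathbb Q^d(2^s)$ the set of points of $U^d$ all of whose coordinates lie in $\mathbb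 Q(2^s)$. For $x\in[0,1)$ and a dyadic rational $t$ (an element of some $\mathbb Q(2^{s'})$), $x\oplus t\in[0,1)$ is defined by $\eta_a(x\oplus t)=\eta_a(x)+\eta_a(t)\bmod 2$ for all $a$; for $X\in U^d$, $T\in\mathbb Q^d(2^{s})$, $X\oplus T$ is defined coordinatewise, and $D\oplus T=\{X\oplus T:X\in D\}$. Mean discrepancies: $\mathcal M_{s,q}[D]=\left(2^{-ds}\sum_{T\in\mathbb Q^d(2^s)}\mathcal L_q[D\oplus T]^q\right)^{1/q}$ for $0<q<\infty$. An elementary box is a set $\prod_{j=1}^d[m_j2^{-a_j},(m_j+1)2^{-a_j})$ with $a_j\in\mathbb N_0$, $0\le m_j\le 2^{a_j}-1$; its volume is $2^{-a_1-\dots-a_d}$. For integers $0\le\delta\le s$, a dyadic $(\delta,s,d)$-net is a set $D_{2^s}\subset U^d$ of $2^s$ points such that every elementary box of volume $2^{\delta-s}$ contains exactly $2^\delta$ points of $D_{2^s}$. *)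

theory Defs
  imports "HOL-Analysis.Analysis"
begin

text \<open>The dimension \<open>d\<close> is \<open>CARD('n)\<close>; points of \<open>U\<^sup>d\<close> are vectors of type \<open>real ^ 'n\<close>.\<close>

definition unit_cube :: "(real ^ 'n) set" where
  "unit_cube = {X. \<forall>i. 0 \<le> X $ i \<and> X $ i < 1}"

definition anchored_box :: "real ^ 'n \<Rightarrow> (real ^ 'n) set" where
  "anchored_box Y = {X. \<forall>i. 0 \<le> X $ i \<and> X $ i < Y $ i}"

definition local_disc :: "(real ^ 'n) set \<Rightarrow> real ^ 'n \<Rightarrow> real" where
  "local_disc D Y = real (card (D \<inter> anchored_box Y)) - real (card D) * (\<Prod>i\<in>UNIV. Y $ i)"

definition Lq_disc :: "real \<Rightarrow> (real ^ 'n) set \<Rightarrow> real" where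
  "Lq_disc q D = (LINT Y:unit_cube|lborel. \<bar>local_disc D Y\<bar> powr q) powr (1 / q)"

text \<open>The sequence \<open>e\<close> is the dyadic expansion of \<open>y\<close>. Digits are indexed by \<open>a \<ge> 1\<close>; the
  unused entry \<open>e 0\<close> is normalised to \<open>0\<close>.\<close>

definition is_dyadic_expansion :: "(nat \<Rightarrow> nat) \<Rightarrow> real \<Rightarrow> bool" where
  "is_dyadic_expansion e y \<longleftrightarrow>
     (\<forall>a. e a \<in> {0, 1}) \<and> e 0 = 0 \<and> infinite {a. 1 \<le> a \<and> e a = 0} \<and>
     (\<lambda>a. real (e a) / 2 ^ a) sums y"

definition dyadic_digit :: "nat \<Rightarrow> real \<Rightarrow> nat" where
  "dyadic_digit a y = (THE e. is_dyadic_expansion e y) a"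

definition dyadic_rats :: "nat \<Rightarrow> real set" where
  "dyadic_rats s = {real m / 2 ^ s | m. m < 2 ^ s}"

definition dyadic_shifts :: "nat \<Rightarrow> (real ^ 'n) set" where
  "dyadic_shifts s = {T. \<forall>i. T $ i \<in> dyadic_rats s}"

definition dyadic_add :: "real \<Rightarrow> real \<Rightarrow> real" where
  "dyadic_add x t =
     (THE z. 0 \<le> z \<and> z < 1 \<and>
        (\<forall>a\<ge>1. dyadic_digit a z = (dyadic_digit a x + dyadic_digit a t) mod 2))"

definition dyadic_add_vec :: "real ^ 'n \<Rightarrow> real ^ 'n \<Rightarrow> real ^ 'n" where
  "dyadic_add_vec X T = (\<chi> i. dyadic_add (X $ i) (T $ i))"

definition dyadic_shift :: "(real ^ 'n) set \<Rightarrow> real ^ 'n \<Rightarrow> (real ^ 'n) set" where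
  "dyadic_shift D T = (\<lambda>X. dyadic_add_vec X T) ` D"

definition mean_disc :: "nat \<Rightarrow> real \<Rightarrow> (real ^ 'n) set \<Rightarrow> real" where
  "mean_disc s q D =
     ((\<Sum>T\<in>dyadic_shifts s. Lq_disc q (dyadic_shift D T) powr q) / 2 ^ (CARD('n) * s)) powr (1 / q)"

definition elementary_box :: "(real ^ 'n) set \<Rightarrow> bool" where
  "elementary_box E \<longleftrightarrow>
     (\<exists>(a :: 'n \<Rightarrow> nat) (m :: 'n \<Rightarrow> nat). (\<forall>i. m i < 2 ^ a i) \<and>
        E = {X. \<forall>i. real (m i) / 2 ^ a i \<le> X $ i \<and> X $ i < (real (m i) + 1) / 2 ^ a i})"

definition dyadic_net :: "nat \<Rightarrow> nat \<Rightarrow> (real ^ 'n) set \<Rightarrow> bool" where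
  "dyadic_net \<delta> s D \<longleftrightarrow>
     \<delta> \<le> s \<and> D \<subseteq> unit_cube \<and> finite D \<and> card D = 2 ^ s \<and>
     (\<forall>E. elementary_box E \<and> measure lborel E = 2 powi (int \<delta> - int s) \<longrightarrow>
        card (D \<inter> E) = 2 ^ \<delta>)"

text \<open>The definite descriptions above are well defined.\<close>

lemma dyadic_tail:
  assumes "is_dyadic_expansion e y"
  shows "(\<Sum>a\<le>n. real (e a) / 2 ^ a) \<le> y" "y < (\<Sum>a\<le>n. real (e a) / 2 ^ a) + 1 / 2 ^ n"
proof -
  let ?f = "\<lambda>a. real (e a) / 2 ^ a"
  have e01: "e a = 0 \<or> e a = 1" for a using assms by (auto simp: is_dyadic_expansion_def)
  have s: "?f sums y" using assms by (auto simp: is_dyadic_expansion_def)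
  show "(\<Sum>a\<le>n. ?f a) \<le> y"
    using sum_le_suminf[of ?f "{..n}"] s by (auto simp: sums_iff)
  have "(\<lambda>k. (1 / 2) ^ k :: real) sums 2"
    using geometric_sums[of "1/2::real"] by simp
  from sums_mult[OF this, of "(1 / 2) ^ Suc n"]
  have g: "(\<lambda>k. 1 / 2 ^ (k + Suc n) :: real) sums (1 / 2 ^ n)"
    by (simp add: power_add power_one_over field_simps)
  have "(\<lambda>k. ?f (k + Suc n)) sums (y - (\<Sum>a<Suc n. ?f a))"
    by (rule sums_split_initial_segment[OF s])
  from sums_diff[OF g this]
  have d: "(\<lambda>k. 1 / 2 ^ (k + Suc n) - ?f (k + Suc n)) sums (1 / 2 ^ n - (y - (\<Sum>a\<le>n. ?f a)))"
    by (simp only: lessThan_Suc_atMost)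
  have nn: "0 \<le> 1 / 2 ^ (k + Suc n) - ?f (k + Suc n)" for k
    using e01[of "k + Suc n"] by auto
  have "infinite {a. 1 \<le> a \<and> e a = 0}" using assms by (auto simp: is_dyadic_expansion_def)
  then obtain a where a: "a > n" "e a = 0"
    by (metis (mono_tags, lifting) infinite_nat_iff_unbounded mem_Collect_eq)
  define k where "k = a - Suc n"
  have "0 < 1 / 2 ^ (k + Suc n) - ?f (k + Suc n)" using a by (simp add: k_def)
  then have "0 < (\<Sum>k. 1 / 2 ^ (k + Suc n) - ?f (k + Suc n))"
    using suminf_pos2[of "\<lambda>k. 1 / 2 ^ (k + Suc n) - ?f (k + Suc n)" k] d nn by (auto simp: sums_iff)
  then show "y < (\<Sum>a\<le>n. ?f a) + 1 / 2 ^ n" using d by (auto simp: sums_iff)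
qed

lemma dyadic_expansion_digit_floor:
  assumes "is_dyadic_expansion e y"
  shows "int (e a) = \<lfloor>2 ^ a * y\<rfloor> mod 2"
proof -
  define S where "S n = (\<Sum>a\<le>n. int (e a) * 2 ^ (n - a))" for n
  have S: "real_of_int (S n) = 2 ^ n * (\<Sum>a\<le>n. real (e a) / 2 ^ a)" for n
  proof -
    have "real_of_int (int (e a) * 2 ^ (n - a)) = 2 ^ n * (real (e a) / 2 ^ a)" if "a \<le> n" for a
    proof -
      have "(2::real) ^ n = 2 ^ a * 2 ^ (n - a)"
        using that by (simp only: power_add[symmetric] le_add_diff_inverse)
      then show ?thesis by simp
    qed
    then have "(\<Sum>a\<le>n. real_of_int (int (e a) * 2 ^ (n - a))) = (\<Sum>a\<le>n. 2 ^ n * (real (e a) / 2 ^ a))"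
      by (intro sum.cong refl) (simp only: atMost_iff)
    then show ?thesis by (simp only: S_def of_int_sum sum_distrib_left)
  qed
  have fl: "\<lfloor>2 ^ n * y\<rfloor> = S n" for n
  proof (rule floor_unique)
    show "real_of_int (S n) \<le> 2 ^ n * y" unfolding S
      by (rule mult_left_mono[OF dyadic_tail(1)[OF assms]]) simp
    have "2 ^ n * y < 2 ^ n * ((\<Sum>a\<le>n. real (e a) / 2 ^ a) + 1 / 2 ^ n)"
      by (rule mult_strict_left_mono[OF dyadic_tail(2)[OF assms]]) simp
    also have "\<dots> = real_of_int (S n) + 1" by (simp only: S distrib_left) simp
    finally show "2 ^ n * y < real_of_int (S n) + 1" .
  qed
  have e01: "e a = 0 \<or> e a = 1" for a using assms by (auto simp: is_dyadic_expansion_def)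
  show ?thesis
  proof (cases a)
    case 0
    have "S 0 = int (e 0)" by (simp add: S_def)
    moreover have "int (e 0) = 0 \<or> int (e 0) = 1" using e01[of 0] by auto
    ultimately show ?thesis unfolding 0 fl by presburger
  next
    case (Suc n)
    have "(\<Sum>a\<le>n. int (e a) * 2 ^ (Suc n - a)) = 2 * S n"
      unfolding S_def sum_distrib_left by (intro sum.cong refl) (simp add: Suc_diff_le)
    then have "S (Suc n) = 2 * S n + int (e (Suc n))"
      by (simp add: S_def[of "Suc n"])
    moreover have "int (e (Suc n)) = 0 \<or> int (e (Suc n)) = 1" using e01[of "Suc n"] by auto
    ultimately show ?thesis unfolding Suc fl by presburger
  qed
qed

lemma dyadic_expansion_floor:
  assumes "0 \<le> y" "y < 1"
  shows "is_dyadic_expansion (\<lambda>a. nat (\<lfloor>2 ^ a * y\<rfloor> mod 2)) y"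
proof -
  define e where "e = (\<lambda>a. nat (\<lfloor>2 ^ a * y\<rfloor> mod 2))"
  have e01: "e a = 0 \<or> e a = 1" for a unfolding e_def by auto
  have y0: "\<lfloor>y\<rfloor> = 0" using assms by linarith
  have e0: "e 0 = 0" by (simp add: e_def y0)
  have part: "(\<Sum>a\<le>n. real (e a) / 2 ^ a) = \<lfloor>2 ^ n * y\<rfloor> / 2 ^ n" for n
  proof (induction n)
    case 0 show ?case by (simp add: e0 y0)
  next
    case (Suc n)
    have "\<lfloor>2 ^ Suc n * y\<rfloor> div 2 = \<lfloor>2 ^ n * y\<rfloor>"
      using floor_divide_real_eq_div[of 2 "2 ^ Suc n * y"] by simp
    moreover have "int (e (Suc n)) = \<lfloor>2 ^ Suc n * y\<rfloor> mod 2"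
      unfolding e_def by simp
    ultimately have K: "\<lfloor>2 ^ Suc n * y\<rfloor> = 2 * \<lfloor>2 ^ n * y\<rfloor> + int (e (Suc n))"
      by presburger
    have "(\<Sum>a\<le>Suc n. real (e a) / 2 ^ a) = \<lfloor>2 ^ n * y\<rfloor> / 2 ^ n + real (e (Suc n)) / 2 ^ Suc n"
      by (simp add: Suc.IH)
    also have "\<dots> = \<lfloor>2 ^ Suc n * y\<rfloor> / 2 ^ Suc n"
      unfolding K by (simp add: add_divide_distrib)
    finally show ?case .
  qed
  have lim: "(\<lambda>n. \<lfloor>2 ^ n * y\<rfloor> / 2 ^ n) \<longlonglongrightarrow> y"
  proof (rule real_tendsto_sandwich[of "\<lambda>n. y - (1/2)^n" _ _ "\<lambda>n. y"])
    have "y - (1/2)^n \<le> \<lfloor>2 ^ n * y\<rfloor> / 2 ^ n" for n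
    proof -
      have "(2 ^ n * y - 1) / 2 ^ n \<le> \<lfloor>2 ^ n * y\<rfloor> / 2 ^ n"
        by (rule divide_right_mono) (linarith, simp)
      then show ?thesis by (simp add: diff_divide_distrib power_one_over)
    qed
    then show "\<forall>\<^sub>F n in sequentially. y - (1/2)^n \<le> \<lfloor>2 ^ n * y\<rfloor> / 2 ^ n" by simp
    have "\<lfloor>2 ^ n * y\<rfloor> / 2 ^ n \<le> y" for n
      by (simp add: divide_le_eq mult.commute)
    then show "\<forall>\<^sub>F n in sequentially. \<lfloor>2 ^ n * y\<rfloor> / 2 ^ n \<le> y" by simp
    show "(\<lambda>n. y - (1/2)^n) \<longlonglongrightarrow> y"
      using tendsto_diff[OF tendsto_const LIMSEQ_power_zero[of "1/2::real"], of y] by simp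
  qed auto
  have s: "(\<lambda>a. real (e a) / 2 ^ a) sums y"
    unfolding sums_def_le part by (rule lim)
  have "infinite {a. 1 \<le> a \<and> e a = 0}"
  proof
    assume "finite {a. 1 \<le> a \<and> e a = 0}"
    then obtain N where "\<forall>a\<in>{a. 1 \<le> a \<and> e a = 0}. a \<le> N"
      using finite_nat_set_iff_bounded_le by blast
    then have one: "e (k + Suc N) = 1" for k using e01[of "k + Suc N"] by force
    have "(\<lambda>k. (1 / 2) ^ k :: real) sums 2"
      using geometric_sums[of "1/2::real"] by simp
    from sums_mult[OF this, of "(1 / 2) ^ Suc N"]
    have "(\<lambda>k. 1 / 2 ^ (k + Suc N) :: real) sums (1 / 2 ^ N)"
      by (simp add: power_add power_one_over field_simps)
    then have g: "(\<lambda>k. real (e (k + Suc N)) / 2 ^ (k + Suc N)) sums (1 / 2 ^ N)"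
      by (simp only: one of_nat_1)
    have "(\<lambda>k. real (e (k + Suc N)) / 2 ^ (k + Suc N)) sums (y - (\<Sum>a<Suc N. real (e a) / 2 ^ a))"
      by (rule sums_split_initial_segment[OF s])
    from sums_unique2[OF this g] have "y = \<lfloor>2 ^ N * y\<rfloor> / 2 ^ N + 1 / 2 ^ N"
      by (simp only: lessThan_Suc_atMost part)
    then have "2 ^ N * y = \<lfloor>2 ^ N * y\<rfloor> + 1" by (simp add: field_simps)
    then show False by linarith
  qed
  then show ?thesis using s e0 e01 unfolding is_dyadic_expansion_def e_def by blast
qed

lemma dyadic_expansion_ex1:
  assumes "0 \<le> y" "y < 1"
  shows "\<exists>!e. is_dyadic_expansion e y"
proof (rule ex1I)
  show "is_dyadic_expansion (\<lambda>a. nat (\<lfloor>2 ^ a * y\<rfloor> mod 2)) y"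
    by (rule dyadic_expansion_floor[OF assms])
next
  fix e assume "is_dyadic_expansion e y"
  from dyadic_expansion_digit_floor[OF this] show "e = (\<lambda>a. nat (\<lfloor>2 ^ a * y\<rfloor> mod 2))"
    by (metis nat_int ext)
qed

lemma dyadic_digit_expansion:
  assumes "0 \<le> y" "y < 1"
  shows "is_dyadic_expansion (\<lambda>a. dyadic_digit a y) y"
  using theI'[of "\<lambda>e. is_dyadic_expansion e y"] dyadic_expansion_ex1[OF assms]
  by (simp add: dyadic_digit_def)

lemma dyadic_digit_eqI:
  assumes "is_dyadic_expansion e y" "0 \<le> y" "y < 1"
  shows "dyadic_digit a y = e a"
  using the1_equality[of "\<lambda>e. is_dyadic_expansion e y" e] dyadic_expansion_ex1[OF assms(2,3)] assms(1)
  by (simp add: dyadic_digit_def)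

lemma dyadic_digit_floor:
  assumes "0 \<le> y" "y < 1"
  shows "dyadic_digit a y = nat (\<lfloor>2 ^ a * y\<rfloor> mod 2)"
  by (rule dyadic_digit_eqI[OF dyadic_expansion_floor[OF assms] assms])

lemma dyadic_add_ex1:
  assumes x: "0 \<le> x" "x < 1" and t: "t \<in> dyadic_rats s"
  shows "\<exists>!z. 0 \<le> z \<and> z < 1 \<and>
           (\<forall>a\<ge>1. dyadic_digit a z = (dyadic_digit a x + dyadic_digit a t) mod 2)"
proof -
  obtain m where m: "t = real m / 2 ^ s" "m < 2 ^ s" using t by (auto simp: dyadic_rats_def)
  have "real m < 2 ^ s" using m(2) by (metis of_nat_less_numeral_power_cancel_iff)
  then have t01: "0 \<le> t" "t < 1" using m by auto
  have t0: "dyadic_digit a t = 0" if as: "a > s" for a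
  proof -
    obtain k where k: "a = s + Suc k" using less_imp_Suc_add[OF as] by auto
    have "2 ^ a * t = real_of_int (2 * (2 ^ k * int m))" by (simp add: m k power_add)
    then have "\<lfloor>2 ^ a * t\<rfloor> = 2 * (2 ^ k * int m)" by (metis floor_of_int)
    then show ?thesis by (simp add: dyadic_digit_floor[OF t01])
  qed
  define f where "f a = (dyadic_digit a x + dyadic_digit a t) mod 2" for a
  note ex = dyadic_digit_expansion[OF x] and et = dyadic_digit_expansion[OF t01]
  have f01: "f a = 0 \<or> f a = 1" for a unfolding f_def by auto
  have f0: "f 0 = 0" using ex et by (simp add: f_def is_dyadic_expansion_def)
  have "{a. 1 \<le> a \<and> dyadic_digit a x = 0} \<subseteq> {..s} \<union> {a. 1 \<le> a \<and> f a = 0}"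
    using t0 by (auto simp: f_def not_le)
  then have inf: "infinite {a. 1 \<le> a \<and> f a = 0}"
    using ex unfolding is_dyadic_expansion_def
    by (meson finite_UnI finite_atMost finite_subset)
  have "summable (\<lambda>a. real (f a) / 2 ^ a)"
  proof (rule summable_comparison_test')
    show "summable (\<lambda>a. (1 / 2) ^ a :: real)" by (simp add: summable_geometric)
    show "norm (real (f a) / 2 ^ a) \<le> (1 / 2) ^ a" if "a \<ge> 0" for a
      using f01[of a] by (auto simp: power_one_over)
  qed
  then obtain z where z: "(\<lambda>a. real (f a) / 2 ^ a) sums z" by (auto simp: summable_def)
  have ez: "is_dyadic_expansion f z"
    using f01 f0 inf z by (auto simp: is_dyadic_expansion_def)
  have z01: "0 \<le> z" "z < 1" using dyadic_tail[OF ez, of 0] by (auto simp: f0)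
  show ?thesis
  proof (rule ex1I[of _ z])
    show "0 \<le> z \<and> z < 1 \<and>
        (\<forall>a\<ge>1. dyadic_digit a z = (dyadic_digit a x + dyadic_digit a t) mod 2)"
      using z01 by (simp add: dyadic_digit_eqI[OF ez z01] f_def)
  next
    fix w assume w: "0 \<le> w \<and> w < 1 \<and>
        (\<forall>a\<ge>1. dyadic_digit a w = (dyadic_digit a x + dyadic_digit a t) mod 2)"
    then have ew: "is_dyadic_expansion (\<lambda>a. dyadic_digit a w) w"
      by (intro dyadic_digit_expansion) auto
    have "dyadic_digit a w = f a" for a
      using w ew f0 by (cases a) (auto simp: f_def is_dyadic_expansion_def)
    then have "(\<lambda>a. dyadic_digit a w) = f" by auto
    then have "(\<lambda>a. real (f a) / 2 ^ a) sums w" using ew by (simp add: is_dyadic_expansion_def)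
    then show "w = z" using z sums_unique2 by blast
  qed
qed

end

theory Submission imports Defs
begin

text \<open>Write \<open>Y = (m + w) / 2 ^ s\<close> and \<open>T = (m \<oplus> \<zeta>) / 2 ^ s\<close> with \<open>m, \<zeta>\<close> integral and \<open>\<oplus>\<close> acting bitwise. For
  fixed \<open>\<zeta>\<close> and \<open>w\<close> the bits of \<open>m\<close> are independent Rademacher variables, and the shifted
  indicator \<open>x \<oplus> T < Y\<close> in one coordinate is \<open>(1 - (\<Sum>k. r\<^sub>k(m) \<epsilon>\<^sub>k(x, \<zeta>))) / 2\<close>, where
  \<open>\<epsilon>\<^sub>k(x, \<zeta>)\<close> is 1 if \<open>x\<close> and \<open>\<zeta>\<close> first differ at the \<open>k\<close>-th bit, and is 0 otherwise; this is exact
  unless \<open>x\<close> and \<open>\<zeta>\<close> agree in all \<open>s\<close> bits, and the net property makes such points rare. The side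
  lengths of the box have similar series. Expanding all coordinates except one, the
  discrepancy becomes, up to an error of \<open>(d - 1) 2 ^ \<delta>\<close>, a Rademacher chaos of order \<open>d - 1\<close>
  whose coefficients are local discrepancies of the net in boxes that are elementary in all
  coordinates but one, hence at most \<open>2 ^ \<delta>\<close>. Even moments of such a chaos are dominated by those
  of the chaos with all coefficients equal to \<open>2 ^ \<delta>\<close>, which factors into one-dimensional
  Khinchin estimates.\<close>

unbundle bit_operations_syntax

section \<open>Dyadic digits and shifts\<close>

text \<open>For \<open>x\<close> in the unit interval this packs the first \<open>s\<close> dyadic
  digits of \<open>x\<close> into one integer, on which a shift acts by \<open>XOR\<close>.\<close>

definition lead :: "nat \<Rightarrow> real \<Rightarrow> nat" where
  "lead s x = nat \<lfloor>2 ^ s * x\<rfloor>"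

text \<open>\<open>rad (Suc k) v\<close> is the sign given by bit \<open>k\<close> of
  \<open>v\<close>, bit 0 being the lowest. Index 0 is the constant function, so one index range
  also covers constant terms.\<close>

definition rad :: "nat \<Rightarrow> nat \<Rightarrow> real" where
  "rad a v = (if a = 0 then 1 else (- 1) ^ (v div 2 ^ (a - 1)))"

lemma lead_unique:
  assumes "real m \<le> 2 ^ s * x" "2 ^ s * x < real m + 1"
  shows "lead s x = m"
proof -
  have "\<lfloor>2 ^ s * x\<rfloor> = int m" using assms by (intro floor_unique) auto
  then show ?thesis by (simp add: lead_def)
qed

lemma lead_bounds:
  assumes "0 \<le> x"
  shows "real (lead s x) \<le> 2 ^ s * x" "2 ^ s * x < real (lead s x) + 1"
proof -
  have "0 \<le> 2 ^ s * x" using assms by simp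
  then have "real (lead s x) = of_int \<lfloor>2 ^ s * x\<rfloor>" by (simp add: lead_def)
  then show "real (lead s x) \<le> 2 ^ s * x" "2 ^ s * x < real (lead s x) + 1" by linarith+
qed

lemma lead_eq_iff:
  assumes "0 \<le> x"
  shows "lead s x = m \<longleftrightarrow> real m / 2 ^ s \<le> x \<and> x < (real m + 1) / 2 ^ s"
  using lead_bounds[OF assms, of s] lead_unique[of m s x] by (auto simp: field_simps)

lemma lead_less:
  assumes "0 \<le> x" "x < 1"
  shows "lead s x < 2 ^ s"
proof -
  have "real (lead s x) < 2 ^ s"
    using lead_bounds(1)[OF assms(1), of s] assms(2) mult_strict_left_mono[OF assms(2), of "2 ^ s"]
    by (smt (verit) mult.right_neutral zero_less_power)
  then show ?thesis by (metis of_nat_less_numeral_power_cancel_iff)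
qed

lemma lead_div:
  assumes "0 \<le> x"
  shows "lead (b + k) x div 2 ^ k = lead b x"
proof -
  have "real (lead (b + k) x div 2 ^ k) = of_int \<lfloor>real (lead (b + k) x) / 2 ^ k\<rfloor>"
    using floor_divide_of_nat_eq[of "lead (b + k) x" "2 ^ k", where 'a = real] by simp
  also have "\<dots> = of_int \<lfloor>2 ^ b * x\<rfloor>"
  proof -
    have "\<lfloor>2 ^ (b + k) * x\<rfloor> div 2 ^ k = \<lfloor>2 ^ b * x\<rfloor>"
      using floor_divide_real_eq_div[of "2 ^ k" "2 ^ (b + k) * x"] by (simp add: power_add)
    moreover have "int (lead (b + k) x) = \<lfloor>2 ^ (b + k) * x\<rfloor>" using assms by (simp add: lead_def)
    ultimately show ?thesis
      using floor_divide_of_int_eq[of "\<lfloor>2 ^ (b + k) * x\<rfloor>" "2 ^ k", where 'a = real]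
      by (metis of_int_numeral of_int_of_nat_eq of_int_power)
  qed
  finally show ?thesis using assms by (simp add: lead_def)
qed

lemma div_xor: "(a XOR b :: nat) div 2 ^ k = (a div 2 ^ k) XOR (b div 2 ^ k)"
  by (simp flip: drop_bit_eq_div)

lemma mod2_xor: "(a XOR b :: nat) mod 2 = (a mod 2 + b mod 2) mod 2"
proof -
  have "odd (a XOR b) \<longleftrightarrow> odd a \<noteq> odd b"
    using bit_xor_iff[of a b 0] by (simp add: bit_0)
  then show ?thesis by (auto simp: mod2_eq_if)
qed

lemma xor_less: "a < 2 ^ s \<Longrightarrow> b < 2 ^ s \<Longrightarrow> (a XOR b :: nat) < 2 ^ s"
  by (metis take_bit_nat_eq_self_iff take_bit_xor)

lemma xor_cancel [simp]: "(a XOR b :: nat) XOR b = a"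
  by (simp add: xor.assoc)

lemma dyadic_digit_lead:
  assumes "0 \<le> y" "y < 1"
  shows "dyadic_digit a y = lead a y mod 2"
  using assms by (simp add: dyadic_digit_floor lead_def nat_mod_distrib)

lemma lead_add_scaled:
  assumes "0 \<le> f" "f < 1"
  shows "lead (s + k) ((real n + f) / 2 ^ s) = n * 2 ^ k + lead k f"
proof (rule lead_unique)
  have "2 ^ (s + k) * ((real n + f) / 2 ^ s) = real n * 2 ^ k + 2 ^ k * f"
    by (simp add: power_add field_simps)
  then show "real (n * 2 ^ k + lead k f) \<le> 2 ^ (s + k) * ((real n + f) / 2 ^ s)"
    and "2 ^ (s + k) * ((real n + f) / 2 ^ s) < real (n * 2 ^ k + lead k f) + 1"
    using lead_bounds[OF assms(1), of k] by simp_all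
qed

lemma lead_scaled:
  assumes "0 \<le> f" "f < 1"
  shows "lead s ((real n + f) / 2 ^ s) = n"
  using assms by (intro lead_unique) auto

lemma scaled_less_1:
  assumes "f < 1" "n < 2 ^ s"
  shows "(real n + f) / 2 ^ s < 1"
proof -
  have "real n + 1 \<le> 2 ^ s" using assms(2) by (metis Suc_eq_plus1 Suc_leI of_nat_1 of_nat_add of_nat_le_numeral_power_cancel_iff)
  then have "real n + f < 2 ^ s" using assms(1) by linarith
  then show ?thesis by simp
qed

text \<open>A shift with \<open>s\<close> digits changes only leading digits and keeps the tail
  \<open>frac (2 ^ s * x)\<close>. The right-hand side is checked digit by digit and identified by
  the uniqueness in \<open>dyadic_add_ex1\<close>.\<close>

lemma dyadic_add_eq:
  assumes x: "0 \<le> x" "x < 1" and n: "n < 2 ^ s"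
  shows "dyadic_add x (real n / 2 ^ s) = (real (lead s x XOR n) + frac (2 ^ s * x)) / 2 ^ s"
proof -
  define f where "f = frac (2 ^ s * x)"
  define N where "N = lead s x XOR n"
  define t where "t = real n / 2 ^ s"
  define z where "z = (real N + f) / 2 ^ s"
  have f: "0 \<le> f" "f < 1" by (auto simp: f_def frac_lt_1)
  have xf: "x = (real (lead s x) + f) / 2 ^ s"
    using x by (simp add: f_def frac_def lead_def)
  have tt: "t = (real n + 0) / 2 ^ s" by (simp add: t_def)
  have t: "0 \<le> t" "t < 1" using scaled_less_1[OF _ n, of 0] by (auto simp: t_def)
  have z: "0 \<le> z" "z < 1"
    using f scaled_less_1[OF f(2) xor_less[OF lead_less[OF x] n]] by (auto simp: z_def N_def)
  have dig: "dyadic_digit a z = (dyadic_digit a x + dyadic_digit a t) mod 2" for a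
  proof (cases "a \<le> s")
    case True
    then obtain k where k: "s = a + k" using le_Suc_ex by blast
    have "lead a z = N div 2 ^ k"
      using lead_div[OF z(1), of a k] lead_scaled[OF f, of s N] by (simp add: z_def k)
    moreover have "lead a x = lead s x div 2 ^ k" using lead_div[OF x(1), of a k] k by simp
    moreover have "lead a t = n div 2 ^ k"
      using lead_div[OF t(1), of a k] lead_scaled[of 0 s n] k by (simp add: t_def)
    ultimately show ?thesis
      by (simp add: dyadic_digit_lead x z t N_def div_xor mod2_xor)
  next
    case False
    \<comment> \<open>Beyond position \<open>s\<close> the integer parts carry the even factor
      \<open>2 ^ Suc k\<close>, so only the common tail \<open>f\<close> contributes to the
      digits.\<close>
    then obtain k where k: "a = s + Suc k" using less_imp_Suc_add[of s a] by auto
    have "lead a z = N * 2 ^ Suc k + lead (Suc k) f"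
      unfolding z_def k by (rule lead_add_scaled[OF f])
    moreover have "lead a x = lead s x * 2 ^ Suc k + lead (Suc k) f"
      using lead_add_scaled[OF f, of s "Suc k" "lead s x"] unfolding xf[symmetric] k .
    moreover have "lead a t = n * 2 ^ Suc k + lead (Suc k) 0"
      unfolding tt k by (rule lead_add_scaled) auto
    moreover have "lead (Suc k) 0 = 0" by (simp add: lead_def)
    ultimately show ?thesis
      by (simp add: dyadic_digit_lead x z t mod2_eq_if)
  qed
  have "t \<in> dyadic_rats s" using n by (auto simp: t_def dyadic_rats_def)
  from the1_equality[OF dyadic_add_ex1[OF x this], of z]
  show ?thesis using dig z by (simp add: dyadic_add_def t_def[symmetric] z_def N_def f_def)
qed

lemma dyadic_add_bounds:
  assumes "0 \<le> x" "x < 1" "n < 2 ^ s"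
  shows "0 \<le> dyadic_add x (real n / 2 ^ s)" "dyadic_add x (real n / 2 ^ s) < 1"
  using scaled_less_1[OF frac_lt_1 xor_less[OF lead_less[OF assms(1,2)] assms(3)], of "2 ^ s * x"]
  by (simp_all add: dyadic_add_eq[OF assms])

lemma lead_dyadic_add:
  assumes "0 \<le> x" "x < 1" "n < 2 ^ s"
  shows "lead s (dyadic_add x (real n / 2 ^ s)) = lead s x XOR n"
  by (simp add: dyadic_add_eq[OF assms] lead_scaled frac_lt_1)

text \<open>\<open>XOR\<close> with \<open>n\<close> is invertible and the tail is unchanged. Hence
  shifted point sets keep their cardinality.\<close>

lemma dyadic_add_inj:
  assumes "0 \<le> x" "x < 1" "0 \<le> x'" "x' < 1" "n < 2 ^ s"
    and eq: "dyadic_add x (real n / 2 ^ s) = dyadic_add x' (real n / 2 ^ s)"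
  shows "x = x'"
proof -
  have "lead s x XOR n = lead s x' XOR n"
    using lead_dyadic_add[of x n s] lead_dyadic_add[of x' n s] assms by simp
  then have l: "lead s x = lead s x'" by (metis xor_cancel)
  with eq have "frac (2 ^ s * x) = frac (2 ^ s * x')"
    using dyadic_add_eq[OF assms(1,2,5)] dyadic_add_eq[OF assms(3,4,5)] by simp
  with l show ?thesis using assms(1,3) by (simp add: frac_def lead_def eq_nat_nat_iff)
qed

text \<open>If \<open>a\<close> and \<open>b\<close> differ, the condition picks out their highest
  differing bit; if they agree, it never holds. That bit is also the highest one where
  \<open>a XOR n\<close> and \<open>b XOR n\<close> differ, so it decides their order.\<close>

lemma sgn_eq_sum_rad:
  assumes "a < 2 ^ s" "b < 2 ^ s" "n < 2 ^ s"
  shows "(\<Sum>k<s. rad (Suc k) (b XOR n) * of_bool (a div 2 ^ k = (b div 2 ^ k) XOR 1))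
     = sgn (real (a XOR n) - real (b XOR n))"
  using assms
proof (induction s arbitrary: a b n)
  case 0
  then show ?case by simp
next
  case (Suc s)
  let ?f = "\<lambda>a b n k. rad (Suc k) (b XOR n) * of_bool (a div 2 ^ k = (b div 2 ^ k) XOR 1)"
  have d: "(b XOR n) div 2 = (b div 2) XOR (n div 2)" "(a XOR n) div 2 = (a div 2) XOR (n div 2)"
    using div_xor[of _ _ 1] by auto
  have sh: "?f a b n (Suc k) = ?f (a div 2) (b div 2) (n div 2) k" for k
    by (simp add: rad_def div_mult2_eq d)
  have "(\<Sum>k<Suc s. ?f a b n k) = ?f a b n 0 + (\<Sum>k<s. ?f a b n (Suc k))"
    by (rule sum.lessThan_Suc_shift)
  also have "(\<Sum>k<s. ?f a b n (Suc k)) = sgn (real (a div 2 XOR n div 2) - real (b div 2 XOR n div 2))"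
    unfolding sh by (rule Suc.IH) (use Suc.prems in auto)
  finally have 1: "(\<Sum>k<Suc s. ?f a b n k) = ?f a b n 0 +
     sgn (real ((a XOR n) div 2) - real ((b XOR n) div 2))" by (simp add: d)
  define A where "A = a XOR n"
  define B where "B = b XOR n"
  have iff: "a = b XOR Suc 0 \<longleftrightarrow> A = B XOR Suc 0"
    unfolding A_def B_def by (metis xor.assoc xor.commute xor_cancel)
  have x1: "B XOR Suc 0 = (if even B then B + 1 else B - 1)"
    by (simp add: xor_Suc_0_eq)
  \<comment> \<open>If the halves agree, the lowest bit alone decides the order; if they differ,
    they decide it and the term of the lowest bit vanishes.\<close>
  have "?f a b n 0 + sgn (real (A div 2) - real (B div 2)) = sgn (real A - real B)"
  proof (cases "A div 2 = B div 2")
    case True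
    note half = True
    show ?thesis
    proof (cases "A = B")
      case True
      then show ?thesis unfolding B_def[symmetric] by (auto simp: iff x1 rad_def elim: oddE)
    next
      case False
      with True consider "even B" "A = B + 1" | "odd B" "A = B - 1"
        by (metis (no_types, opaque_lifting) add.commute dvd_mult_div_cancel even_two_times_div_two odd_two_times_div_two_succ add_diff_cancel_left' plus_1_eq_Suc)
      then show ?thesis
      proof cases
        case 1 then show ?thesis unfolding B_def[symmetric] by (auto simp: iff x1 rad_def)
      next
        case 2
        then have "B > 0" by (auto elim: oddE)
        with 2 show ?thesis unfolding half B_def[symmetric] by (auto simp: iff x1 rad_def of_nat_diff)
      qed
    qed
  next
    case False
    have "A \<noteq> B XOR Suc 0"
    proof
      assume "A = B XOR Suc 0"
      then have "A div 2 = B div 2" using div_xor[of B 1 1] by simp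
      with False show False ..
    qed
    moreover have "A < B \<longleftrightarrow> A div 2 < B div 2" "A > B \<longleftrightarrow> A div 2 > B div 2" using False by presburger+
    ultimately show ?thesis
      unfolding B_def[symmetric] by (auto simp: iff sgn_if)
  qed
  then show ?case unfolding 1 A_def B_def .
qed

text \<open>\<open>rad (Suc k) m\<close> is 1 minus twice bit \<open>k\<close> of \<open>m\<close>,
  so this is a geometric sum minus twice the number formed by the low \<open>s\<close> bits.\<close>

lemma sum_rad_powers: 
  "(\<Sum>k<s. rad (Suc k) m * 2 ^ k) = 2 ^ s - 1 - 2 * real (m mod 2 ^ s)"
proof (induction s arbitrary: m)
  case (Suc s)
  have "rad (Suc (Suc k)) m = rad (Suc k) (m div 2)" for k
    by (simp add: rad_def div_mult2_eq)
  then have "(\<Sum>k<Suc s. rad (Suc k) m * 2 ^ k) = rad 1 m + 2 * (\<Sum>k<s. rad (Suc k) (m div 2) * 2 ^ k)"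
    by (subst sum.lessThan_Suc_shift) (simp add: sum_distrib_left algebra_simps)
  also have "\<dots> = rad 1 m + 2 * (2 ^ s - 1 - 2 * real (m div 2 mod 2 ^ s))" by (simp only: Suc.IH)
  also have "\<dots> = 2 ^ Suc s - 1 - 2 * real (m mod 2 ^ Suc s)"
  proof -
    have "m mod 2 ^ Suc s = 2 * (m div 2 mod 2 ^ s) + m mod 2" by (simp add: mod_mult2_eq)
    then show ?thesis by (auto simp: rad_def mod2_eq_if)
  qed
  finally show ?case .
qed simp

section \<open>Moments of Rademacher sums\<close>

lemma sum_double_split:
  fixes f :: "nat \<Rightarrow> 'a :: comm_monoid_add"
  shows "(\<Sum>v<2 ^ Suc s. f v) = (\<Sum>u<2 ^ s. f (2 * u) + f (2 * u + 1))"
proof -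
  have "(\<Sum>v<2 * n. f v) = (\<Sum>u<n. f (2 * u) + f (2 * u + 1))" for n
    by (induction n) (simp_all add: add.assoc)
  then show ?thesis by simp
qed

lemma rad_0 [simp]: "rad 0 v = 1"
  by (simp add: rad_def)

lemma rad_double [simp]:
  "rad (Suc (Suc k)) (2 * u) = rad (Suc k) u"
  "rad (Suc (Suc k)) (Suc (2 * u)) = rad (Suc k) u"
  "rad (Suc 0) (2 * u) = 1" "rad (Suc 0) (Suc (2 * u)) = -1"
  by (simp_all add: rad_def div_mult2_eq)

text \<open>The bits of a uniform \<open>v\<close> are independent signs. Summing out the lowest bit
  yields a factor \<open>1 + c\<close> with \<open>c\<close> a sign, which is 0 or 2.\<close>

lemma sum_prod_rad_nonneg:
  assumes "finite K"
  shows "0 \<le> (\<Sum>v<2 ^ s. \<Prod>k\<in>K. rad (\<alpha> k) v)"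
proof (induction s arbitrary: \<alpha>)
  case 0
  have "rad a 0 = 1" for a by (simp add: rad_def)
  then show ?case by simp
next
  case (Suc s)
  \<comment> \<open>Halving \<open>v\<close> lowers indices by one. Truncated subtraction sends both
    0 and 1 to the constant function; the sign lost from index 1 is collected in
    \<open>c\<close>.\<close>
  define \<beta> where "\<beta> k = \<alpha> k - 1" for k
  define c :: real where "c = (\<Prod>k\<in>K. if \<alpha> k = 1 then -1 else 1)"
  have c: "\<bar>c\<bar> = 1" unfolding c_def abs_prod by (intro prod.neutral) auto
  have e: "rad (\<alpha> k) (2 * u) = rad (\<beta> k) u"
    "rad (\<alpha> k) (2 * u + 1) = (if \<alpha> k = 1 then -1 else 1) * rad (\<beta> k) u" for k u
    by (cases "\<alpha> k"; cases "\<alpha> k - 1"; simp add: \<beta>_def)+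
  have "(\<Sum>v<2 ^ Suc s. \<Prod>k\<in>K. rad (\<alpha> k) v)
      = (\<Sum>u<2 ^ s. (1 + c) * (\<Prod>k\<in>K. rad (\<beta> k) u))"
    unfolding sum_double_split e prod.distrib c_def[symmetric] by (simp add: algebra_simps)
  also have "\<dots> = (1 + c) * (\<Sum>u<2 ^ s. \<Prod>k\<in>K. rad (\<beta> k) u)"
    by (simp add: sum_distrib_left)
  also have "\<dots> \<ge> 0" using c Suc.IH[of \<beta>] by (intro mult_nonneg_nonneg) auto
  finally show ?case .
qed

lemma power_sum_PiE:
  fixes f :: "'a \<Rightarrow> 'b :: comm_semiring_1"
  assumes "finite A"
  shows "(\<Sum>a\<in>A. f a) ^ n = (\<Sum>\<phi>\<in>{..<n} \<rightarrow>\<^sub>E A. \<Prod>k<n. f (\<phi> k))"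
proof -
  have "(\<Sum>a\<in>A. f a) ^ n = (\<Prod>k<n. \<Sum>a\<in>A. f a)" by simp
  also have "\<dots> = (\<Sum>\<phi>\<in>{..<n} \<rightarrow>\<^sub>E A. \<Prod>k<n. f (\<phi> k))"
    by (rule prod_sum_PiE) (use assms in auto)
  finally show ?thesis .
qed

text \<open>All mixed moments of the Rademacher system are nonnegative, so the moments of a
  multilinear form increase when its coefficients are replaced by a common bound; the resulting
  form is a product of forms in one variable each.\<close>

lemma rad_chaos_domination:
  fixes A :: "('i \<Rightarrow> nat) \<Rightarrow> real"
  assumes I: "finite I" and A: "\<And>a. a \<in> I \<rightarrow>\<^sub>E {..s} \<Longrightarrow> \<bar>A a\<bar> \<le> C"
  shows "(\<Sum>m\<in>I \<rightarrow>\<^sub>E {..<2 ^ s}. (\<Sum>a\<in>I \<rightarrow>\<^sub>E {..s}. A a * (\<Prod>i\<in>I. rad (a i) (m i))) ^ n)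
    \<le> C ^ n * (\<Sum>v<2 ^ s. (\<Sum>a\<le>s. rad a v) ^ n) ^ card I"
proof -
  let ?J = "I \<rightarrow>\<^sub>E {..s}" and ?M = "I \<rightarrow>\<^sub>E {..<(2::nat) ^ s}"
  let ?\<Phi> = "{..<n} \<rightarrow>\<^sub>E ?J"
  have fJ: "finite ?J" by (intro finite_PiE I) auto
  \<comment> \<open>The unnormalised mixed moment attached to \<open>\<phi>\<close>; it factors over
    \<open>I\<close> because the entries of \<open>m\<close> vary independently.\<close>
  define E where "E \<phi> = (\<Prod>i\<in>I. \<Sum>v<2 ^ s. \<Prod>k<n. rad (\<phi> k i) v)" for \<phi> :: "nat \<Rightarrow> 'i \<Rightarrow> nat"
  have E0: "0 \<le> E \<phi>" for \<phi> unfolding E_def by (intro prod_nonneg ballI sum_prod_rad_nonneg) auto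
  have expand: "(\<Sum>m\<in>?M. (\<Sum>a\<in>?J. B a * (\<Prod>i\<in>I. rad (a i) (m i))) ^ n)
    = (\<Sum>\<phi>\<in>?\<Phi>. (\<Prod>k<n. B (\<phi> k)) * E \<phi>)" for B
  proof -
    have "(\<Sum>m\<in>?M. (\<Sum>a\<in>?J. B a * (\<Prod>i\<in>I. rad (a i) (m i))) ^ n)
      = (\<Sum>m\<in>?M. \<Sum>\<phi>\<in>?\<Phi>. (\<Prod>k<n. B (\<phi> k)) * (\<Prod>i\<in>I. \<Prod>k<n. rad (\<phi> k i) (m i)))"
      by (simp add: power_sum_PiE[OF fJ] prod.distrib prod.swap[of _ I])
    also have "\<dots> = (\<Sum>\<phi>\<in>?\<Phi>. (\<Prod>k<n. B (\<phi> k)) * (\<Sum>m\<in>?M. \<Prod>i\<in>I. \<Prod>k<n. rad (\<phi> k i) (m i)))"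
      by (subst sum.swap) (simp add: sum_distrib_left)
    also have "\<dots> = (\<Sum>\<phi>\<in>?\<Phi>. (\<Prod>k<n. B (\<phi> k)) * E \<phi>)"
      unfolding E_def by (subst prod_sum_PiE) (use I in auto)
    finally show ?thesis .
  qed
  have "(\<Sum>\<phi>\<in>?\<Phi>. (\<Prod>k<n. A (\<phi> k)) * E \<phi>) \<le> (\<Sum>\<phi>\<in>?\<Phi>. C ^ n * E \<phi>)"
  proof (intro sum_mono mult_right_mono E0)
    fix \<phi> assume \<phi>: "\<phi> \<in> ?\<Phi>"
    have "(\<Prod>k<n. A (\<phi> k)) \<le> (\<Prod>k<n. \<bar>A (\<phi> k)\<bar>)"
      by (metis abs_ge_self abs_prod)
    also have "\<dots> \<le> (\<Prod>k<n. C)"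
      by (intro prod_mono conjI abs_ge_zero A) (use \<phi> in \<open>auto simp: PiE_iff\<close>)
    finally show "(\<Prod>k<n. A (\<phi> k)) \<le> C ^ n" by simp
  qed
  also have "\<dots> = C ^ n * (\<Sum>m\<in>?M. (\<Sum>a\<in>?J. \<Prod>i\<in>I. rad (a i) (m i)) ^ n)"
    using expand[of "\<lambda>_. 1"] by (simp add: sum_distrib_left)
  also have "(\<Sum>m\<in>?M. (\<Sum>a\<in>?J. \<Prod>i\<in>I. rad (a i) (m i)) ^ n)
     = (\<Sum>m\<in>?M. \<Prod>i\<in>I. (\<Sum>a\<le>s. rad a (m i)) ^ n)"
  proof -
    have "(\<Sum>a\<in>?J. \<Prod>i\<in>I. rad (a i) (m i)) = (\<Prod>i\<in>I. \<Sum>a\<le>s. rad a (m i))" for m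
      using prod_sum_PiE[of I "\<lambda>_. {..s}" "\<lambda>i a. rad a (m i)"] I by simp
    then show ?thesis by (simp add: prod_power_distrib)
  qed
  also have "\<dots> = (\<Sum>v<2 ^ s. (\<Sum>a\<le>s. rad a v) ^ n) ^ card I"
    using prod_sum_PiE[of I "\<lambda>_. {..<2 ^ s}" "\<lambda>_ v. (\<Sum>a\<le>s. rad a v) ^ n"] I by simp
  finally show ?thesis unfolding expand .
qed

text \<open>Averaging over a sign added to \<open>x\<close> cancels the odd powers. This drives the
  induction in \<open>sum_rad_even_moment\<close>.\<close>

lemma even_binomial_symm:
  fixes x :: real
  shows "(x + 1) ^ (2 * p) + (x - 1) ^ (2 * p) = 2 * (\<Sum>k\<le>p. real (2 * p choose 2 * k) * x ^ (2 * k))"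
proof -
  let ?f = "\<lambda>j. real (2 * p choose j) * x ^ j"
  have "(x + 1) ^ (2 * p) + (x - 1) ^ (2 * p) = (\<Sum>j\<le>2 * p. ?f j * (1 + (-1) ^ (2 * p - j)))"
    using binomial_ring[of x 1 "2 * p"] binomial_ring[of x "-1" "2 * p"]
    by (simp add: algebra_simps sum.distrib)
  also have "\<dots> = (\<Sum>j\<in>(\<lambda>k. 2 * k) ` {..p}. ?f j * (1 + (-1) ^ (2 * p - j)))"
  proof (intro sum.mono_neutral_right ballI)
    fix j assume j: "j \<in> {..2 * p} - (\<lambda>k. 2 * k) ` {..p}"
    have "odd j"
    proof
      assume "even j"
      then obtain k where "j = 2 * k" by blast
      with j show False by auto
    qed
    with j have "odd (2 * p - j)" by auto
    then show "?f j * (1 + (-1) ^ (2 * p - j)) = 0" by simp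
  qed auto
  also have "\<dots> = (\<Sum>k\<le>p. ?f (2 * k) * (1 + (-1) ^ (2 * p - 2 * k)))"
    by (subst sum.reindex) (auto simp: inj_on_def)
  also have "\<dots> = (\<Sum>k\<le>p. 2 * ?f (2 * k))"
  proof (intro sum.cong refl)
    fix k
    have "even (2 * p - 2 * k)" by simp
    then show "?f (2 * k) * (1 + (-1) ^ (2 * p - 2 * k)) = 2 * ?f (2 * k)" by simp
  qed
  finally show ?thesis by (simp add: sum_distrib_left)
qed

text \<open>The quotient of the two sides is the product of the odd numbers below
  \<open>2 * k\<close>, which is at least 1.\<close>

lemma fact_double_ge: "2 ^ k * fact k \<le> (fact (2 * k) :: real)"
proof (induction k)
  case (Suc k)
  have "2 ^ Suc k * fact (Suc k) = 2 * (real k + 1) * (2 ^ k * fact k :: real)" by (simp add: algebra_simps)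
  also have "\<dots> \<le> 2 * (real k + 1) * fact (2 * k)" by (intro mult_left_mono Suc) auto
  also have "\<dots> \<le> (2 * real k + 1) * (2 * (real k + 1) * fact (2 * k))"
    using mult_right_mono[of 1 "2 * real k + 1" "2 * (real k + 1) * fact (2 * k)"] by simp
  also have "\<dots> = fact (2 * Suc k)" by (simp add: algebra_simps)
  finally show ?case .
qed simp

text \<open>Khinchin's inequality with the Gaussian constant: the quotient of factorials is the
  \<open>2 * p\<close>-th moment of a standard normal variable. The factor \<open>real s + 1\<close>
  counts the constant term along with the \<open>s\<close> signs.\<close>

lemma sum_rad_even_moment:
  "(\<Sum>v<2 ^ s. (\<Sum>a\<le>s. rad a v) ^ (2 * p))
     \<le> 2 ^ s * (fact (2 * p) / (2 ^ p * fact p) * (real s + 1) ^ p)"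
proof (induction s arbitrary: p)
  case 0
  show ?case using fact_double_ge[of p] by simp
next
  case (Suc s)
  let ?S = "\<lambda>s v. \<Sum>a\<le>s. rad a v"
  let ?c = "\<lambda>p. fact (2 * p) / (2 ^ p * fact p) :: real"
  \<comment> \<open>The lowest bit of \<open>v\<close> acts as a fresh sign added to the sum for the
    remaining bits.\<close>
  have e: "?S (Suc s) (2 * u) = ?S s u + 1" "?S (Suc s) (2 * u + 1) = ?S s u - 1" for u
  proof -
    have "?S (Suc s) v = rad 0 v + (rad 1 v + (\<Sum>a<s. rad (Suc (Suc a)) v))" for v
      by (simp only: sum.atMost_shift sum.lessThan_Suc_shift One_nat_def)
    moreover have "?S s u = 1 + (\<Sum>a<s. rad (Suc a) u)"
      by (simp add: sum.atMost_shift)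
    ultimately show "?S (Suc s) (2 * u) = ?S s u + 1" "?S (Suc s) (2 * u + 1) = ?S s u - 1"
      by simp_all
  qed
  have "(\<Sum>v<2 ^ Suc s. ?S (Suc s) v ^ (2 * p))
    = (\<Sum>u<2 ^ s. 2 * (\<Sum>k\<le>p. real (2 * p choose 2 * k) * ?S s u ^ (2 * k)))"
    unfolding sum_double_split e even_binomial_symm ..
  also have "\<dots> = 2 * (\<Sum>k\<le>p. real (2 * p choose 2 * k) * (\<Sum>u<2 ^ s. ?S s u ^ (2 * k)))"
    by (simp add: sum_distrib_left) (subst sum.swap, simp)
  also have "\<dots> \<le> 2 * (\<Sum>k\<le>p. real (2 * p choose 2 * k) * (2 ^ s * (?c k * (real s + 1) ^ k)))"
    by (intro mult_left_mono sum_mono Suc.IH) auto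
  also have "\<dots> = 2 ^ Suc s * (\<Sum>k\<le>p. real (2 * p choose 2 * k) * ?c k * (real s + 1) ^ k)"
    by (simp add: sum_distrib_left algebra_simps)
  \<comment> \<open>Cancelling \<open>fact (2 * k)\<close> leaves \<open>fact (2 * (p - k))\<close>
    in a denominator. Bounding it below by \<open>fact_double_ge\<close> turns the coefficients into
    those of the binomial theorem for \<open>(real s + 1) + 1\<close>.\<close>
  also have "\<dots> \<le> 2 ^ Suc s * (\<Sum>k\<le>p. ?c p * (real (p choose k) * (real s + 1) ^ k))"
  proof (intro mult_left_mono sum_mono)
    fix k assume "k \<in> {..p}"
    then have k: "k \<le> p" by simp
    have "real (2 * p choose 2 * k) * ?c k = fact (2 * p) / (2 ^ k * fact k * fact (2 * (p - k)))"
      using k binomial_fact[of "2 * k" "2 * p", where 'a = real]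
      unfolding right_diff_distrib'[of 2 p k, symmetric] by simp
    also have "\<dots> \<le> fact (2 * p) / (2 ^ k * fact k * (2 ^ (p - k) * fact (p - k)))"
      by (intro divide_left_mono mult_left_mono fact_double_ge) auto
    also have "\<dots> = ?c p * real (p choose k)"
      using k binomial_fact[of k p, where 'a = real]
      by (simp add: field_simps flip: power_add)
    finally have "real (2 * p choose 2 * k) * ?c k \<le> ?c p * real (p choose k)" .
    then show "real (2 * p choose 2 * k) * ?c k * (real s + 1) ^ k \<le> ?c p * (real (p choose k) * (real s + 1) ^ k)"
      unfolding mult.assoc[symmetric] by (rule mult_right_mono) simp
  qed simp
  also have "(\<Sum>k\<le>p. ?c p * (real (p choose k) * (real s + 1) ^ k)) = ?c p * (real (Suc s) + 1) ^ p"
    using binomial_ring[of "real s + 1" 1 p] by (simp add: sum_distrib_left add.commute)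
  finally show ?case .
qed

text \<open>\<open>fact (2 * p) / fact p\<close> is a product of \<open>p\<close> factors, each at
  most \<open>2 * p\<close>.\<close>

lemma double_fact_le: "fact (2 * p) / (2 ^ p * fact p) \<le> real p ^ p"
proof -
  have "fact (p + k) \<le> (2 * real p) ^ k * fact p" if "k \<le> p" for k
    using that
  proof (induction k)
    case (Suc k)
    have "fact (p + Suc k) = (real p + real k + 1) * fact (p + k)" by (simp add: algebra_simps)
    also have "\<dots> \<le> (2 * real p) * ((2 * real p) ^ k * fact p)"
      using Suc by (intro mult_mono) auto
    finally show ?case by simp
  qed simp
  from this[of p] show ?thesis
    by (simp add: divide_le_eq power_mult_distrib ac_simps flip: mult_2)
qed

lemma sum_rad_even_moment_le:
  "(\<Sum>v<2 ^ s. (\<Sum>a\<le>s. rad a v) ^ (2 * p)) \<le> 2 ^ s * (real p * (real s + 1)) ^ p"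
proof -
  have "2 ^ s * (fact (2 * p) / (2 ^ p * fact p) * (real s + 1) ^ p)
     \<le> 2 ^ s * (real p ^ p * (real s + 1) ^ p)"
    by (intro mult_left_mono mult_right_mono double_fact_le) auto
  with sum_rad_even_moment[of s p] show ?thesis by (simp add: power_mult_distrib)
qed

section \<open>Counting points of a net\<close>

lemma borel_measurable_vec_component [measurable]:
  "(\<lambda>x :: real ^ 'n. x $ i) \<in> borel_measurable borel"
  by (intro borel_measurable_continuous_onI continuous_intros)

lemma half_open_box_borel [measurable]:
  "{X :: real ^ 'n. \<forall>i. l i \<le> X $ i \<and> X $ i < u i} \<in> sets borel"
  by measurable

text \<open>The box lies between the open and the closed box with the same corners, which have equal
  measure.\<close>

lemma measure_half_open_box:
  fixes l u :: "'n :: finite \<Rightarrow> real"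
  assumes "\<And>i. l i < u i"
  shows "{X :: real ^ 'n. \<forall>i. l i \<le> X $ i \<and> X $ i < u i} \<in> fmeasurable lborel"
    and "measure lborel {X :: real ^ 'n. \<forall>i. l i \<le> X $ i \<and> X $ i < u i} = (\<Prod>i\<in>UNIV. u i - l i)"
proof -
  let ?E = "{X :: real ^ 'n. \<forall>i. l i \<le> X $ i \<and> X $ i < u i}"
  let ?l = "vec_lambda l :: real ^ 'n" and ?u = "vec_lambda u :: real ^ 'n"
  have sub: "box ?l ?u \<subseteq> ?E" "?E \<subseteq> cbox ?l ?u"
    by (auto simp: mem_box_cart less_imp_le)
  show fm: "?E \<in> fmeasurable lborel"
    by (rule fmeasurableI2[OF fmeasurable_cbox sub(2)]) simp
  have ne: "cbox ?l ?u \<noteq> {}"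
    using assms by (auto simp: interval_ne_empty_cart less_imp_le)
  have c: "measure lborel (cbox ?l ?u) = (\<Prod>i\<in>UNIV. u i - l i)"
    using content_cbox_cart[OF ne] by simp
  have "measure lborel (box ?l ?u) = measure lborel (cbox ?l ?u)"
    using ne by (simp add: measure_lborel_cbox_eq measure_lborel_box_eq)
  with c have b: "measure lborel (box ?l ?u) = (\<Prod>i\<in>UNIV. u i - l i)" by simp
  have "measure lborel (box ?l ?u) \<le> measure lborel ?E"
    by (rule measure_mono_fmeasurable[OF sub(1) _ fm]) simp
  moreover have "measure lborel ?E \<le> measure lborel (cbox ?l ?u)"
    by (rule measure_mono_fmeasurable[OF sub(2) _ fmeasurable_cbox]) simp
  ultimately show "measure lborel ?E = (\<Prod>i\<in>UNIV. u i - l i)" using b c by linarith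
qed

text \<open>Prescribing the first \<open>c i\<close> digits in every coordinate cuts out an
  elementary box; the condition on the sum gives it the volume in the definition of a net.\<close>

lemma dyadic_net_card_eq:
  fixes D :: "(real ^ 'n) set"
  assumes net: "dyadic_net \<delta> s D" and c: "(\<Sum>i\<in>UNIV. c i) = s - \<delta>" and M: "\<And>i. M i < 2 ^ c i"
  shows "card {x \<in> D. \<forall>i. lead (c i) (x $ i) = M i} = 2 ^ \<delta>"
proof -
  let ?E = "{X :: real ^ 'n. \<forall>i. real (M i) / 2 ^ c i \<le> X $ i \<and> X $ i < (real (M i) + 1) / 2 ^ c i}"
  have "\<delta> \<le> s" and D: "D \<subseteq> unit_cube" using net by (auto simp: dyadic_net_def)
  have "measure lborel ?E = (\<Prod>i\<in>UNIV. 1 / 2 ^ c i)"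
    by (subst measure_half_open_box) (auto simp: divide_strict_right_mono add_divide_distrib)
  also have "\<dots> = 1 / 2 ^ (s - \<delta>)" by (simp add: prod_dividef flip: power_sum c)
  also have "\<dots> = 2 powi (int \<delta> - int s)"
    using \<open>\<delta> \<le> s\<close> by (simp add: power_int_def nat_diff_distrib inverse_eq_divide power_one_over)
  finally have "card (D \<inter> ?E) = 2 ^ \<delta>"
    using net M unfolding dyadic_net_def elementary_box_def by blast
  moreover have "D \<inter> ?E = {x \<in> D. \<forall>i. lead (c i) (x $ i) = M i}"
    using D by (auto simp: unit_cube_def lead_eq_iff subset_iff)
  ultimately show ?thesis by simp
qed

text \<open>Forgetting prescribed digits one at a time enlarges the box until it has the volume for
  which the count is exact.\<close>

lemma dyadic_net_card_le:
  fixes D :: "(real ^ 'n) set"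
  assumes net: "dyadic_net \<delta> s D" and "s - \<delta> \<le> (\<Sum>i\<in>UNIV. c i)" and "\<And>i. M i < 2 ^ c i"
  shows "card {x \<in> D. \<forall>i. lead (c i) (x $ i) = M i} \<le> 2 ^ \<delta>"
  using assms(2,3)
proof (induction "(\<Sum>i\<in>UNIV. c i)" arbitrary: c M)
  case 0
  then show ?case using dyadic_net_card_eq[OF net, of c M] by simp
next
  case (Suc N)
  show ?case
  proof (cases "(\<Sum>i\<in>UNIV. c i) = s - \<delta>")
    case True
    then show ?thesis using dyadic_net_card_eq[OF net, of c M] Suc.prems by simp
  next
    case False
    have "\<exists>k. c k \<noteq> 0" using Suc.hyps(2) by (metis Zero_not_Suc sum.neutral)
    then obtain k b where k: "c k = Suc b" by (meson not0_implies_Suc)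
    define c' where "c' = c(k := b)"
    define M' where "M' = M(k := M k div 2)"
    have "(\<Sum>i\<in>UNIV. c i) = Suc (\<Sum>i\<in>UNIV. c' i)"
      by (simp add: c'_def sum.remove[of UNIV k] k)
    with Suc.hyps(2) False Suc.prems(1) have N: "N = (\<Sum>i\<in>UNIV. c' i)" "s - \<delta> \<le> (\<Sum>i\<in>UNIV. c' i)" by auto
    have M': "M' i < 2 ^ c' i" for i using Suc.prems(2)[of i] by (auto simp: M'_def c'_def k)
    have fin: "finite D" and D: "D \<subseteq> unit_cube" using net by (auto simp: dyadic_net_def)
    have "{x \<in> D. \<forall>i. lead (c i) (x $ i) = M i} \<subseteq> {x \<in> D. \<forall>i. lead (c' i) (x $ i) = M' i}"
    proof safe
      fix x i assume x: "x \<in> D" "\<forall>i. lead (c i) (x $ i) = M i"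
      then have "0 \<le> x $ i" using D by (auto simp: unit_cube_def)
      from lead_div[OF this, of b 1] show "lead (c' i) (x $ i) = M' i"
        using x(2)[rule_format, of i] by (auto simp: c'_def M'_def k)
    qed
    from card_mono[OF _ this] Suc.hyps(1)[OF N M'] fin show ?thesis by simp
  qed
qed

text \<open>The slab is an elementary box of volume \<open>1 / 2 ^ s\<close>. The bound controls the
  points agreeing with \<open>\<zeta>\<close> in all \<open>s\<close> bits of one coordinate, where
  the smoothed indicator is inexact.\<close>

lemma dyadic_net_slab_card_le:
  fixes D :: "(real ^ 'n) set"
  assumes net: "dyadic_net \<delta> s D" and "n < 2 ^ s"
  shows "card {x \<in> D. lead s (x $ i) = n} \<le> 2 ^ \<delta>"
proof -
  let ?c = "\<lambda>k. if k = i then s else 0" and ?M = "\<lambda>k. if k = i then n else 0"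
  have D: "finite D" "D \<subseteq> unit_cube" using net by (auto simp: dyadic_net_def)
  have "lead 0 (x $ k) = 0" if "x \<in> D" for x k
    using D that lead_less[of "x $ k" 0] by (auto simp: unit_cube_def)
  then have "{x \<in> D. lead s (x $ i) = n} = {x \<in> D. \<forall>k. lead (?c k) (x $ k) = ?M k}" by auto
  moreover have "card \<dots> \<le> 2 ^ \<delta>"
    by (rule dyadic_net_card_le[OF net]) (use assms(2) in auto)
  ultimately show ?thesis by simp
qed

text \<open>The boxes of volume \<open>2 ^ \<delta> / 2 ^ s\<close> stacked in direction \<open>j\<close> contain exactly \<open>2 ^ \<delta>\<close> points each,
  so only the one whose \<open>j\<close>-th side contains \<open>y\<close> contributes to the discrepancy.\<close>

lemma dyadic_net_column_disc:
  fixes D :: "(real ^ 'n) set"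
  assumes net: "dyadic_net \<delta> s D" and M: "\<And>i. M i < 2 ^ c i"
    and n: "n < 2 ^ s" and y: "0 \<le> y" "y < 1" and cj: "c j = 0"
  shows "\<bar>real (card {x \<in> D. (\<forall>i\<in>UNIV - {j}. lead (c i) (x $ i) = M i) \<and> dyadic_add (x $ j) (real n / 2 ^ s) < y})
    - 2 ^ s * y / 2 ^ (\<Sum>i\<in>UNIV. c i)\<bar> \<le> 2 ^ \<delta>"
proof -
  let ?z = "\<lambda>x. dyadic_add (x $ j) (real n / 2 ^ s)"
  define P where "P = {x \<in> D. \<forall>i\<in>UNIV - {j}. lead (c i) (x $ i) = M i}"
  define Q where "Q = {x \<in> P. ?z x < y}"
  let ?K = "\<Sum>i\<in>UNIV. c i"
  have D: "finite D" "D \<subseteq> unit_cube" "\<delta> \<le> s" using net by (auto simp: dyadic_net_def)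
  have fP: "finite P" using D by (simp add: P_def)
  have xj: "0 \<le> x $ j" "x $ j < 1" if "x \<in> P" for x
    using that D by (auto simp: P_def unit_cube_def)
  have Qeq: "{x \<in> D. (\<forall>i\<in>UNIV - {j}. lead (c i) (x $ i) = M i) \<and> ?z x < y} = Q"
    by (auto simp: Q_def P_def)
  have "\<bar>real (card Q) - 2 ^ s * y / 2 ^ ?K\<bar> \<le> 2 ^ \<delta>"
  \<comment> \<open>Either the column has volume at least \<open>2 ^ \<delta> / 2 ^ s\<close> and
    splits into \<open>2 ^ b\<close> slices of exactly this volume, or it is smaller and holds few
    points anyway.\<close>
  proof (cases "?K \<le> s - \<delta>")
    case True
    then obtain b where b: "s - \<delta> = ?K + b" using le_Suc_ex by blast
    then obtain k where k: "s = b + k" using D(3) by (metis add.commute add.assoc le_add_diff_inverse)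
    define n' where "n' = n div 2 ^ k"
    have n': "n' < 2 ^ b" using n by (simp add: n'_def k power_add less_mult_imp_div_less)
    have z: "lead b (?z x) = lead b (x $ j) XOR n'" "0 \<le> ?z x" if "x \<in> P" for x
    proof -
      show z0: "0 \<le> ?z x" using dyadic_add_bounds[OF xj[OF that] n] by simp
      have "lead b (?z x) = (lead s (x $ j) XOR n) div 2 ^ k"
        using lead_div[OF z0, of b k] lead_dyadic_add[OF xj[OF that] n] by (simp add: k)
      also have "\<dots> = lead b (x $ j) XOR n'"
        using lead_div[OF xj(1)[OF that], of b k] by (simp add: k n'_def div_xor)
      finally show "lead b (?z x) = lead b (x $ j) XOR n'" .
    qed
    have one: "card {x \<in> P. lead b (?z x) = v} = 2 ^ \<delta>" if v: "v < 2 ^ b" for v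
    proof -
      let ?c = "c(j := b)" and ?M = "M(j := v XOR n')"
      have "{x \<in> P. lead b (?z x) = v} = {x \<in> P. lead b (x $ j) = v XOR n'}"
        using z(1) by (auto simp: xor.assoc)
      also have "\<dots> = {x \<in> D. \<forall>i. lead (?c i) (x $ i) = ?M i}"
        by (auto simp: P_def)
      also have "card \<dots> = 2 ^ \<delta>"
      proof (rule dyadic_net_card_eq[OF net])
        show "(\<Sum>i\<in>UNIV. ?c i) = s - \<delta>"
          using b cj by (simp add: sum.remove[of UNIV j])
        show "?M i < 2 ^ ?c i" for i using M xor_less[OF v n'] by simp
      qed
      finally show ?thesis .
    qed
    have many: "card {x \<in> P. lead b (?z x) < v} = v * 2 ^ \<delta>" if "v \<le> 2 ^ b" for v
      using that
    proof (induction v)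
      case (Suc v)
      have "{x \<in> P. lead b (?z x) < Suc v} = {x \<in> P. lead b (?z x) < v} \<union> {x \<in> P. lead b (?z x) = v}"
        by auto
      also have "card \<dots> = v * 2 ^ \<delta> + 2 ^ \<delta>"
        using Suc one[of v] fP by (subst card_Un_disjoint) auto
      finally show ?case by simp
    qed simp
    let ?v = "lead b y"
    note yb = lead_bounds[OF y(1), of b]
    have "{x \<in> P. lead b (?z x) < ?v} \<subseteq> Q"
    proof -
      have "?z x < y" if "x \<in> P" "lead b (?z x) < ?v" for x
      proof -
        have "2 ^ b * ?z x < 2 ^ b * y"
          using lead_bounds(2)[OF z(2)[OF that(1)], of b] that(2) yb(1) by linarith
        then show ?thesis by simp
      qed
      then show ?thesis by (auto simp: Q_def)
    qed
    moreover have "finite Q" using fP by (simp add: Q_def)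
    ultimately have "card {x \<in> P. lead b (?z x) < ?v} \<le> card Q" by (intro card_mono)
    then have "?v * 2 ^ \<delta> \<le> card Q"
      using many[of ?v] lead_less[OF y, of b] by simp
    then have lo: "real ?v * 2 ^ \<delta> \<le> real (card Q)" by (metis of_nat_mono of_nat_mult of_nat_numeral of_nat_power)
    have "Q \<subseteq> {x \<in> P. lead b (?z x) < Suc ?v}"
    proof -
      have "lead b (?z x) < Suc ?v" if "x \<in> P" "?z x < y" for x
      proof -
        have "2 ^ b * ?z x < 2 ^ b * y" using that by simp
        then have "real (lead b (?z x)) < real ?v + 1"
          using lead_bounds(1)[OF z(2)[OF that(1)], of b] yb(2) by linarith
        then show ?thesis by linarith
      qed
      then show ?thesis by (auto simp: Q_def)
    qed
    then have "card Q \<le> card {x \<in> P. lead b (?z x) < Suc ?v}"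
      using fP by (intro card_mono) auto
    also have "\<dots> = Suc ?v * 2 ^ \<delta>"
      by (rule many) (use lead_less[OF y, of b] in simp)
    finally have "card Q \<le> Suc ?v * 2 ^ \<delta>" .
    then have hi: "real (card Q) \<le> (real ?v + 1) * 2 ^ \<delta>"
      by (metis of_nat_mono of_nat_mult of_nat_numeral of_nat_power of_nat_Suc add.commute)
    have "s = \<delta> + b + ?K" using b D(3) by linarith
    then have "2 ^ s * y / 2 ^ ?K = (2 ^ b * y) * 2 ^ \<delta>"
      by (simp add: power_add)
    moreover have "real ?v * 2 ^ \<delta> \<le> (2 ^ b * y) * 2 ^ \<delta>" "(2 ^ b * y) * 2 ^ \<delta> \<le> (real ?v + 1) * 2 ^ \<delta>"
      using yb by (intro mult_right_mono; simp)+
    ultimately show ?thesis using lo hi unfolding distrib_right abs_le_iff by linarith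
  next
    case False
    \<comment> \<open>Here the count and its expected value both lie between 0 and
      \<open>2 ^ \<delta>\<close>.\<close>
    have "lead 0 (x $ j) = 0" if "x \<in> P" for x
      using lead_less[OF xj[OF that], of 0] by simp
    then have "Q \<subseteq> {x \<in> D. \<forall>i. lead (c i) (x $ i) = (M(j := 0)) i}"
      using cj by (auto simp: P_def Q_def)
    then have "card Q \<le> card {x \<in> D. \<forall>i. lead (c i) (x $ i) = (M(j := 0)) i}"
      using D(1) by (intro card_mono) auto
    also have "\<dots> \<le> 2 ^ \<delta>"
      by (rule dyadic_net_card_le[OF net]) (use False M in auto)
    finally have "card Q \<le> 2 ^ \<delta>" .
    then have "real (card Q) \<le> 2 ^ \<delta>" by (metis of_nat_le_numeral_power_cancel_iff)
    moreover have "2 ^ s * y / 2 ^ ?K \<le> 2 ^ \<delta>"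
    proof -
      have "(2::real) ^ s \<le> 2 ^ (\<delta> + ?K)" using False by (intro power_increasing) auto
      then have "2 ^ s * y \<le> 2 ^ (\<delta> + ?K) * 1" using y by (intro mult_mono) auto
      then show ?thesis by (simp add: power_add divide_le_eq)
    qed
    moreover have "0 \<le> 2 ^ s * y / 2 ^ ?K" using y by simp
    ultimately show ?thesis unfolding abs_le_iff by linarith
  qed
  then show ?thesis unfolding Qeq .
qed

section \<open>The Rademacher series of the discrepancy\<close>

text \<open>The \<open>a\<close>-th coefficients in the Rademacher series, in the upper end point, of the smoothed
  indicator of an anchored interval and of its length. For \<open>a = Suc k\<close> the first one is the
  negated indicator that the top digits of \<open>\<xi>\<close> and \<open>\<zeta>\<close> first differ at bit \<open>k\<close>.\<close>

definition ind_coeff :: "nat \<Rightarrow> nat \<Rightarrow> nat \<Rightarrow> real" where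
  "ind_coeff a \<xi> \<zeta> = (if a = 0 then 1 else - of_bool (\<xi> div 2 ^ (a - 1) = (\<zeta> div 2 ^ (a - 1)) XOR 1))"

definition len_coeff :: "nat \<Rightarrow> nat \<Rightarrow> real" where
  "len_coeff s a = (if a = 0 then 1 else - (2 ^ (a - 1) / 2 ^ s))"

text \<open>The value is 1/2 at \<open>u = m\<close>: a tie is broken by later digits, and this
  symmetric choice makes the Rademacher series exact.\<close>

definition smooth_ind :: "nat \<Rightarrow> nat \<Rightarrow> real" where
  "smooth_ind u m = (1 - sgn (real u - real m)) / 2"

text \<open>Taking the midpoint of the cell makes the constant term of the series exactly 1/2, as
  for the smoothed indicator.\<close>

definition smooth_len :: "nat \<Rightarrow> nat \<Rightarrow> real" where
  "smooth_len s m = (real m + 1 / 2) / 2 ^ s"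

text \<open>The shift \<open>m XOR \<zeta>\<close> takes \<open>\<zeta>\<close> to \<open>m\<close>,
  so comparing with \<open>m\<close> means comparing the shifts of \<open>\<xi>\<close> and
  \<open>\<zeta>\<close>. Only the signs depend on \<open>m\<close>, not the coefficients.\<close>

lemma smooth_ind_eq_sum:
  assumes "\<xi> < 2 ^ s" "\<zeta> < 2 ^ s" "m < 2 ^ s"
  shows "smooth_ind (\<xi> XOR (m XOR \<zeta>)) m = (\<Sum>a\<le>s. rad a m * ind_coeff a \<xi> \<zeta>) / 2"
proof -
  have "\<zeta> XOR (m XOR \<zeta>) = m" by (metis xor.commute xor_cancel)
  then have "(\<Sum>k<s. rad (Suc k) m * of_bool (\<xi> div 2 ^ k = (\<zeta> div 2 ^ k) XOR 1))
    = sgn (real (\<xi> XOR (m XOR \<zeta>)) - real m)"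
    using sgn_eq_sum_rad[OF assms(1,2) xor_less[OF assms(3,2)]] by simp
  then show ?thesis
    by (simp add: smooth_ind_def sum.atMost_shift ind_coeff_def sum_negf)
qed

lemma smooth_len_eq_sum:
  assumes "m < 2 ^ s"
  shows "smooth_len s m = (\<Sum>a\<le>s. rad a m * len_coeff s a) / 2"
proof -
  have "(\<Sum>a\<le>s. rad a m * len_coeff s a) = 1 - (\<Sum>k<s. rad (Suc k) m * 2 ^ k) / 2 ^ s"
    by (simp add: sum.atMost_shift len_coeff_def sum_negf sum_divide_distrib)
  also have "\<dots> = 2 * smooth_len s m"
    using assms by (simp add: sum_rad_powers smooth_len_def field_simps)
  finally show ?thesis by simp
qed

lemma smooth_ind_bounds: "\<bar>smooth_ind u m\<bar> \<le> 1"
  by (simp add: smooth_ind_def sgn_if)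

text \<open>Unless \<open>u = m\<close>, the integer parts alone decide the order.\<close>

lemma smooth_ind_error:
  assumes "0 \<le> f" "f < 1" "0 \<le> w" "w < 1"
  shows "\<bar>of_bool ((real u + f) / 2 ^ s < (real m + w) / 2 ^ s) - smooth_ind u m\<bar> \<le> of_bool (u = m) / 2"
proof -
  consider "u < m" | "u = m" | "u > m" by linarith
  then show ?thesis
  proof cases
    case 1
    then have "real u + 1 \<le> real m" by linarith
    then have "real u + f < real m + w" using assms by linarith
    with 1 show ?thesis by (simp add: smooth_ind_def divide_less_cancel)
  next
    case 3
    then have "real m + 1 \<le> real u" by linarith
    then have "\<not> real u + f < real m + w" using assms by linarith
    with 3 show ?thesis by (simp add: smooth_ind_def divide_less_cancel)
  qed (simp add: smooth_ind_def)
qed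

lemma smooth_len_bounds:
  assumes "m < 2 ^ s"
  shows "\<bar>smooth_len s m\<bar> \<le> 1"
  using scaled_less_1[of "1 / 2" m s] assms by (simp add: smooth_len_def)

lemma smooth_len_error:
  assumes "0 \<le> w" "w < 1"
  shows "\<bar>(real m + w) / 2 ^ s - smooth_len s m\<bar> \<le> 1 / (2 * 2 ^ s)"
proof -
  have "(real m + w) / 2 ^ s - smooth_len s m = (w - 1 / 2) / 2 ^ s"
    unfolding smooth_len_def diff_divide_distrib[symmetric] by simp
  then have "\<bar>(real m + w) / 2 ^ s - smooth_len s m\<bar> = \<bar>w - 1 / 2\<bar> / 2 ^ s" by simp
  also have "\<bar>w - 1 / 2\<bar> \<le> 1 / 2" using assms by linarith
  then have "\<bar>w - 1 / 2\<bar> / 2 ^ s \<le> (1 / 2) / 2 ^ s" by (rule divide_right_mono) simp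
  finally show ?thesis by simp
qed

section \<open>Discretisation of box corners and shifts\<close>

definition cell_point :: "nat \<Rightarrow> ('n \<Rightarrow> nat) \<Rightarrow> real ^ 'n \<Rightarrow> real ^ 'n" where
  "cell_point s m W = (\<chi> i. real (m i) / 2 ^ s + W $ i)"

definition shift_point :: "nat \<Rightarrow> ('n \<Rightarrow> nat) \<Rightarrow> real ^ 'n" where
  "shift_point s \<tau> = (\<chi> i. real (\<tau> i) / 2 ^ s)"

definition cell :: "nat \<Rightarrow> (real ^ 'n) set" where
  "cell s = {W. \<forall>i. 0 \<le> W $ i \<and> W $ i < 1 / 2 ^ s}"

text \<open>The offset \<open>W\<close> of the box corner inside its cell and the unexpanded
  coordinate \<open>j\<close> are held fixed, while the cell index \<open>m\<close> and
  \<open>\<zeta>\<close> vary.\<close>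

locale shifted_net =
  fixes D :: "(real ^ 'n) set" and \<delta> s :: nat and j :: 'n and W :: "real ^ 'n"
  assumes net: "dyadic_net \<delta> s D" and W: "W \<in> cell s"
begin

abbreviation I :: "'n set" where "I \<equiv> UNIV - {j}"
abbreviation P :: "('n \<Rightarrow> nat) set" where "P \<equiv> UNIV \<rightarrow>\<^sub>E {..<2 ^ s}"

lemma net_facts: "finite D" "D \<subseteq> unit_cube" "card D = 2 ^ s"
  using net by (auto simp: dyadic_net_def)

lemma D_nth: "x \<in> D \<Longrightarrow> 0 \<le> x $ i" "x \<in> D \<Longrightarrow> x $ i < 1"
  using net_facts by (auto simp: unit_cube_def)

definition coord :: "('n \<Rightarrow> nat) \<Rightarrow> 'n \<Rightarrow> real" where "coord m i = (real (m i) + 2 ^ s * W $ i) / 2 ^ s"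

lemma offset_bounds: "0 \<le> 2 ^ s * W $ i" "2 ^ s * W $ i < 1"
  using W by (auto simp: cell_def field_simps)

lemma cell_point_nth: "cell_point s m W $ i = coord m i"
  by (simp add: cell_point_def coord_def field_simps)

lemma P_less: "m \<in> P \<Longrightarrow> m i < 2 ^ s"
  by (auto simp: PiE_iff)

lemma coord_bounds: "0 \<le> coord m i" "m \<in> P \<Longrightarrow> coord m i < 1"
  using offset_bounds[of i] scaled_less_1[of "2 ^ s * W $ i" "m i" s] P_less[of m i] by (auto simp: coord_def)

definition below :: "('n \<Rightarrow> nat) \<Rightarrow> ('n \<Rightarrow> nat) \<Rightarrow> real ^ 'n \<Rightarrow> 'n \<Rightarrow> real" where
  "below m \<zeta> x i = of_bool (dyadic_add (x $ i) (real (m i XOR \<zeta> i) / 2 ^ s) < coord m i)"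

text \<open>The shift is injective on \<open>D\<close>, so counting shifted points amounts to
  summing over \<open>D\<close> itself, and the indicator of the box factors over
  coordinates.\<close>

lemma local_disc_eq:
  assumes m: "m \<in> P" and z: "\<zeta> \<in> P"
  shows "local_disc (dyadic_shift D (shift_point s (\<lambda>i. m i XOR \<zeta> i))) (cell_point s m W)
    = (\<Sum>x\<in>D. \<Prod>i\<in>UNIV. below m \<zeta> x i) - 2 ^ s * (\<Prod>i\<in>UNIV. coord m i)"
proof -
  let ?T = "shift_point s (\<lambda>i. m i XOR \<zeta> i) :: real ^ 'n"
  let ?g = "\<lambda>X. dyadic_add_vec X ?T"
  have tl: "m i XOR \<zeta> i < 2 ^ s" for i using P_less[OF m] P_less[OF z] by (intro xor_less)
  have g: "?g X $ i = dyadic_add (X $ i) (real (m i XOR \<zeta> i) / 2 ^ s)" for X i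
    by (simp add: dyadic_add_vec_def shift_point_def)
  have inj: "inj_on ?g D"
  proof (rule inj_onI)
    fix x y assume xy: "x \<in> D" "y \<in> D" "?g x = ?g y"
    show "x = y"
    proof (rule vec_eq_iff[THEN iffD2], rule allI)
      fix i
      show "x $ i = y $ i"
        by (rule dyadic_add_inj[OF D_nth[OF xy(1)] D_nth[OF xy(2)] tl[of i]])
          (use xy(3) g in metis)
    qed
  qed
  have c1: "card (dyadic_shift D ?T) = 2 ^ s"
    using card_image[OF inj] net_facts(3) by (simp add: dyadic_shift_def)
  let ?R = "{x \<in> D. \<forall>i. ?g x $ i < coord m i}"
  have "dyadic_shift D ?T \<inter> anchored_box (cell_point s m W) = ?g ` ?R"
    using dyadic_add_bounds(1)[OF D_nth tl] by (auto simp: dyadic_shift_def anchored_box_def cell_point_nth g)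
  moreover have "card (?g ` ?R) = card ?R"
    by (rule card_image, rule inj_on_subset[OF inj]) auto
  moreover have "real (card ?R) = (\<Sum>x\<in>D. \<Prod>i\<in>UNIV. below m \<zeta> x i)"
  proof -
    have "(\<Prod>i\<in>UNIV. below m \<zeta> x i) = of_bool (\<forall>i. ?g x $ i < coord m i)" for x
    proof (cases "\<forall>i. ?g x $ i < coord m i")
      case False
      then show ?thesis by (auto simp: below_def g intro!: prod_zero)
    qed (simp add: below_def g)
    then show ?thesis using net_facts(1) by (simp add: Int_def)
  qed
  ultimately show ?thesis by (simp add: local_disc_def c1 cell_point_nth)
qed

text \<open>Coordinate \<open>j\<close> keeps its exact indicator and length. This lowers the order
  of the chaos to \<open>CARD('n) - 1\<close> and lets the net property act along direction
  \<open>j\<close>.\<close>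

definition main_term :: "('n \<Rightarrow> nat) \<Rightarrow> ('n \<Rightarrow> nat) \<Rightarrow> real" where
  "main_term m \<zeta> = (\<Sum>x\<in>D. below m \<zeta> x j * (\<Prod>i\<in>I. smooth_ind (lead s (x $ i) XOR (m i XOR \<zeta> i)) (m i)))
    - 2 ^ s * (coord m j * (\<Prod>i\<in>I. smooth_len s (m i)))"

text \<open>Factors bounded by 1 are replaced one coordinate at a time. Each coordinate in
  \<open>I\<close> costs at most \<open>2 ^ \<delta> / 2\<close> in the count, by the slab bound,
  and at most 1/2 in the volume term.\<close>

lemma main_term_error:
  assumes m: "m \<in> P" and z: "\<zeta> \<in> P"
  shows "\<bar>(\<Sum>x\<in>D. \<Prod>i\<in>UNIV. below m \<zeta> x i) - 2 ^ s * (\<Prod>i\<in>UNIV. coord m i) - main_term m \<zeta>\<bar>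
     \<le> (real CARD('n) - 1) * 2 ^ \<delta>"
proof -
  define h where "h x i = smooth_ind (lead s (x $ i) XOR (m i XOR \<zeta> i)) (m i)" for x :: "real ^ 'n" and i
  have tl: "m i XOR \<zeta> i < 2 ^ s" for i using P_less[OF m] P_less[OF z] by (intro xor_less)
  have cI: "real (card I) = real CARD('n) - 1" by (simp add: card_Diff_singleton of_nat_diff)
  have bj: "\<bar>below m \<zeta> x i\<bar> \<le> 1" for x i by (simp add: below_def)
  have e1: "\<bar>below m \<zeta> x i - h x i\<bar> \<le> of_bool (lead s (x $ i) = \<zeta> i) / 2" if "x \<in> D" for x i
  proof -
    \<comment> \<open>A tie with \<open>m\<close> after the shift means agreement with
      \<open>\<zeta>\<close> before it.\<close>
    have "(lead s (x $ i) XOR (m i XOR \<zeta> i) = m i) \<longleftrightarrow> lead s (x $ i) = \<zeta> i"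
      by (metis xor.assoc xor.commute xor_cancel)
    then show ?thesis
      using smooth_ind_error[of "frac (2 ^ s * x $ i)" "2 ^ s * W $ i"
          "lead s (x $ i) XOR (m i XOR \<zeta> i)" s "m i"] offset_bounds[of i]
      by (simp add: frac_lt_1 below_def h_def coord_def dyadic_add_eq[OF D_nth[OF that] tl])
  qed
  have p1: "\<bar>(\<Prod>i\<in>I. below m \<zeta> x i) - (\<Prod>i\<in>I. h x i)\<bar> \<le> (\<Sum>i\<in>I. of_bool (lead s (x $ i) = \<zeta> i) / 2)"
    if "x \<in> D" for x
  proof -
    have "\<bar>(\<Prod>i\<in>I. below m \<zeta> x i) - (\<Prod>i\<in>I. h x i)\<bar> \<le> (\<Sum>i\<in>I. \<bar>below m \<zeta> x i - h x i\<bar>)"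
      using norm_prod_diff[of I "below m \<zeta> x" "h x"] bj smooth_ind_bounds by (simp add: h_def)
    also have "\<dots> \<le> (\<Sum>i\<in>I. of_bool (lead s (x $ i) = \<zeta> i) / 2)"
      by (intro sum_mono e1 that)
    finally show ?thesis .
  qed
  have "\<bar>(\<Sum>x\<in>D. below m \<zeta> x j * (\<Prod>i\<in>I. below m \<zeta> x i)) - (\<Sum>x\<in>D. below m \<zeta> x j * (\<Prod>i\<in>I. h x i))\<bar>
     \<le> (\<Sum>x\<in>D. \<bar>below m \<zeta> x j * ((\<Prod>i\<in>I. below m \<zeta> x i) - (\<Prod>i\<in>I. h x i))\<bar>)"
    unfolding right_diff_distrib sum_subtractf[symmetric] by (rule sum_abs)
  also have "\<dots> \<le> (\<Sum>x\<in>D. 1 * (\<Sum>i\<in>I. of_bool (lead s (x $ i) = \<zeta> i) / 2))"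
    unfolding abs_mult by (intro sum_mono mult_mono bj p1) auto
  also have "\<dots> = (\<Sum>i\<in>I. real (card {x \<in> D. lead s (x $ i) = \<zeta> i}) / 2)"
    using net_facts(1) by (simp, subst sum.swap, simp add: sum_divide_distrib[symmetric] Int_def)
  also have "\<dots> \<le> (\<Sum>i\<in>I. 2 ^ \<delta> / 2)"
  proof (intro sum_mono divide_right_mono)
    fix i show "real (card {x \<in> D. lead s (x $ i) = \<zeta> i}) \<le> 2 ^ \<delta>"
      using dyadic_net_slab_card_le[OF net P_less[OF z], of i i] by (metis of_nat_le_numeral_power_cancel_iff)
  qed simp
  also have "\<dots> = (real CARD('n) - 1) * 2 ^ \<delta> / 2" by (simp add: cI)
  finally have E1: "\<bar>(\<Sum>x\<in>D. below m \<zeta> x j * (\<Prod>i\<in>I. below m \<zeta> x i))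
    - (\<Sum>x\<in>D. below m \<zeta> x j * (\<Prod>i\<in>I. h x i))\<bar> \<le> (real CARD('n) - 1) * 2 ^ \<delta> / 2" .
  have "\<bar>(\<Prod>i\<in>I. coord m i) - (\<Prod>i\<in>I. smooth_len s (m i))\<bar> \<le> (\<Sum>i\<in>I. \<bar>coord m i - smooth_len s (m i)\<bar>)"
    using norm_prod_diff[of I "coord m" "\<lambda>i. smooth_len s (m i)"] coord_bounds(1)[of m] coord_bounds(2)[OF m]
      smooth_len_bounds[OF P_less[OF m]] by (simp add: less_imp_le)
  also have "\<dots> \<le> (\<Sum>i\<in>I. 1 / (2 * 2 ^ s))"
    by (intro sum_mono) (simp only: coord_def, intro smooth_len_error offset_bounds)
  also have "\<dots> = (real CARD('n) - 1) / (2 * 2 ^ s)" by (simp add: cI)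
  finally have "\<bar>coord m j * ((\<Prod>i\<in>I. coord m i) - (\<Prod>i\<in>I. smooth_len s (m i)))\<bar> \<le> 1 * ((real CARD('n) - 1) / (2 * 2 ^ s))"
    unfolding abs_mult using coord_bounds[of m j] m by (intro mult_mono) auto
  then have "2 ^ s * \<bar>coord m j * ((\<Prod>i\<in>I. coord m i) - (\<Prod>i\<in>I. smooth_len s (m i)))\<bar> \<le> (real CARD('n) - 1) / 2"
    by (simp add: field_simps)
  also have "\<dots> \<le> (real CARD('n) - 1) * 2 ^ \<delta> / 2"
    unfolding cI[symmetric] by (intro divide_right_mono) (simp_all add: mult_le_cancel_left1)
  finally have E2: "\<bar>2 ^ s * (coord m j * (\<Prod>i\<in>I. coord m i)) - 2 ^ s * (coord m j * (\<Prod>i\<in>I. smooth_len s (m i)))\<bar>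
     \<le> (real CARD('n) - 1) * 2 ^ \<delta> / 2"
    unfolding right_diff_distrib[symmetric] abs_mult by simp
  have split: "(\<Prod>i\<in>UNIV. f i) = f j * (\<Prod>i\<in>I. f i)" for f :: "'n \<Rightarrow> real"
    by (rule prod.remove) auto
  show ?thesis unfolding split main_term_def h_def[symmetric] using E1 E2 by linarith
qed

text \<open>Coordinate \<open>j\<close> is written out with \<open>v\<close> in place of
  \<open>m j\<close>: the coefficients see \<open>m\<close> only through this entry and stay
  constant while the others vary.\<close>

definition coeff :: "nat \<Rightarrow> ('n \<Rightarrow> nat) \<Rightarrow> ('n \<Rightarrow> nat) \<Rightarrow> real" where
  "coeff v \<zeta> a = (\<Sum>x\<in>D. of_bool (dyadic_add (x $ j) (real (v XOR \<zeta> j) / 2 ^ s) < (real v + 2 ^ s * W $ j) / 2 ^ s)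
       * (\<Prod>i\<in>I. ind_coeff (a i) (lead s (x $ i)) (\<zeta> i)))
    - 2 ^ s * ((real v + 2 ^ s * W $ j) / 2 ^ s * (\<Prod>i\<in>I. len_coeff s (a i)))"

text \<open>The one-dimensional series are multiplied out; every expanded coordinate contributes a
  factor 1/2.\<close>

lemma main_term_eq_sum:
  assumes m: "m \<in> P" and z: "\<zeta> \<in> P"
  shows "main_term m \<zeta> = (\<Sum>a\<in>I \<rightarrow>\<^sub>E {..s}. coeff (m j) \<zeta> a * (\<Prod>i\<in>I. rad (a i) (m i))) / 2 ^ card I"
proof -
  let ?J = "I \<rightarrow>\<^sub>E {..s}"
  let ?r = "\<lambda>a. \<Prod>i\<in>I. rad (a i) (m i)"
  have h: "(\<Prod>i\<in>I. smooth_ind (lead s (x $ i) XOR (m i XOR \<zeta> i)) (m i))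
    = (\<Sum>a\<in>?J. ?r a * (\<Prod>i\<in>I. ind_coeff (a i) (lead s (x $ i)) (\<zeta> i))) / 2 ^ card I" if "x \<in> D" for x
  proof -
    have "(\<Prod>i\<in>I. smooth_ind (lead s (x $ i) XOR (m i XOR \<zeta> i)) (m i))
      = (\<Prod>i\<in>I. (\<Sum>a\<le>s. rad a (m i) * ind_coeff a (lead s (x $ i)) (\<zeta> i)) / 2)"
      using lead_less[OF D_nth[OF that]] P_less[OF m] P_less[OF z]
      by (intro prod.cong refl smooth_ind_eq_sum) auto
    also have "\<dots> = (\<Sum>a\<in>?J. ?r a * (\<Prod>i\<in>I. ind_coeff (a i) (lead s (x $ i)) (\<zeta> i))) / 2 ^ card I"
      unfolding prod_dividef by (subst prod_sum_PiE) (auto simp: prod.distrib)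
    finally show ?thesis .
  qed
  have l: "(\<Prod>i\<in>I. smooth_len s (m i)) = (\<Sum>a\<in>?J. ?r a * (\<Prod>i\<in>I. len_coeff s (a i))) / 2 ^ card I"
    unfolding smooth_len_eq_sum[OF P_less[OF m]] prod_dividef
    by (subst prod_sum_PiE) (auto simp: prod.distrib)
  define B where "B x = below m \<zeta> x j" for x
  define K where "K x a = (\<Prod>i\<in>I. ind_coeff (a i) (lead s (x $ i)) (\<zeta> i))" for x :: "real ^ 'n" and a
  define L where "L a = (\<Prod>i\<in>I. len_coeff s (a i))" for a :: "'n \<Rightarrow> nat"
  have c: "coeff (m j) \<zeta> a = (\<Sum>x\<in>D. B x * K x a) - 2 ^ s * (coord m j * L a)" for a
    by (simp add: coeff_def B_def K_def L_def below_def coord_def)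
  have "main_term m \<zeta> = (\<Sum>x\<in>D. B x * ((\<Sum>a\<in>?J. ?r a * K x a) / 2 ^ card I))
     - 2 ^ s * (coord m j * ((\<Sum>a\<in>?J. ?r a * L a) / 2 ^ card I))"
    unfolding main_term_def l B_def[symmetric] L_def[symmetric]
    by (simp add: h flip: K_def cong: sum.cong)
  also have "\<dots> = ((\<Sum>x\<in>D. \<Sum>a\<in>?J. B x * (?r a * K x a)) - (\<Sum>a\<in>?J. 2 ^ s * (coord m j * (?r a * L a)))) / 2 ^ card I"
    by (simp add: sum_distrib_left diff_divide_distrib sum_divide_distrib)
  also have "(\<Sum>x\<in>D. \<Sum>a\<in>?J. B x * (?r a * K x a)) = (\<Sum>a\<in>?J. \<Sum>x\<in>D. B x * (?r a * K x a))"
    by (rule sum.swap)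
  also have "(\<Sum>a\<in>?J. \<Sum>x\<in>D. B x * (?r a * K x a)) - (\<Sum>a\<in>?J. 2 ^ s * (coord m j * (?r a * L a)))
     = (\<Sum>a\<in>?J. coeff (m j) \<zeta> a * ?r a)"
    unfolding c sum_subtractf[symmetric]
    by (intro sum.cong refl) (simp add: sum_distrib_left sum_distrib_right algebra_simps)
  finally show ?thesis .
qed

text \<open>Up to the sign \<open>\<sigma>\<close>, the coefficient is a count minus its expected
  value in a column with prescribed leading digits in \<open>I\<close> and an upper bound in
  direction \<open>j\<close>, as in \<open>dyadic_net_column_disc\<close>.\<close>

lemma coeff_le:
  assumes v: "v < 2 ^ s" and z: "\<zeta> \<in> P" and a: "a \<in> I \<rightarrow>\<^sub>E {..s}"
  shows "\<bar>coeff v \<zeta> a\<bar> \<le> 2 ^ \<delta>"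
proof -
  \<comment> \<open>Index \<open>a i = Suc k\<close> prescribes the digits of
    \<open>\<zeta> i\<close> above bit \<open>k\<close> and the flipped bit \<open>k\<close>, in all
    \<open>s - k\<close> leading digits; index 0 prescribes none.\<close>
  define c where "c i = (if i = j \<or> a i = 0 then 0 else s - (a i - 1))" for i
  define M where "M i = (if i = j \<or> a i = 0 then 0 else (\<zeta> i div 2 ^ (a i - 1)) XOR 1)" for i
  define y where "y = (real v + 2 ^ s * W $ j) / 2 ^ s"
  define \<sigma> :: real where "\<sigma> = (\<Prod>i\<in>I. if a i = 0 then 1 else -1)"
  have \<sigma>: "\<bar>\<sigma>\<bar> = 1" unfolding \<sigma>_def abs_prod by (intro prod.neutral) auto
  have as: "a i \<le> s" if "i \<noteq> j" for i using a that by (auto simp: PiE_iff)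
  have M: "M i < 2 ^ c i" for i
  proof (cases "i = j \<or> a i = 0")
    case False
    then have "s = c i + (a i - 1)" "c i > 0" using as[of i] by (auto simp: c_def)
    then have "\<zeta> i div 2 ^ (a i - 1) < 2 ^ c i"
      using P_less[OF z, of i] by (metis less_mult_imp_div_less power_add)
    moreover have "(1::nat) < 2 ^ c i" using \<open>c i > 0\<close> by (intro one_less_power) auto
    ultimately show ?thesis using False xor_less[of _ "c i" 1] by (simp add: M_def)
  qed (auto simp: M_def c_def)
  have K: "(\<Prod>i\<in>I. ind_coeff (a i) (lead s (x $ i)) (\<zeta> i)) = \<sigma> * of_bool (\<forall>i\<in>I. lead (c i) (x $ i) = M i)"
    if x: "x \<in> D" for x
  proof -
    have "ind_coeff (a i) (lead s (x $ i)) (\<zeta> i) = (if a i = 0 then 1 else -1) * of_bool (lead (c i) (x $ i) = M i)"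
      if "i \<in> I" for i
    proof (cases "a i = 0")
      case True
      then show ?thesis using lead_less[OF D_nth(1)[OF x, of i] D_nth(2)[OF x, of i], of 0] that by (simp add: ind_coeff_def c_def M_def)
    next
      case False
      then have "s = c i + (a i - 1)" using as[of i] that by (auto simp: c_def)
      then have "lead s (x $ i) div 2 ^ (a i - 1) = lead (c i) (x $ i)"
        using lead_div[OF D_nth(1)[OF x, of i], of "c i" "a i - 1"] by simp
      then show ?thesis using that False by (simp add: ind_coeff_def M_def)
    qed
    then have "(\<Prod>i\<in>I. ind_coeff (a i) (lead s (x $ i)) (\<zeta> i)) = \<sigma> * (\<Prod>i\<in>I. of_bool (lead (c i) (x $ i) = M i))"
      by (simp add: \<sigma>_def prod.distrib)
    also have "(\<Prod>i\<in>I. of_bool (lead (c i) (x $ i) = M i)) = (of_bool (\<forall>i\<in>I. lead (c i) (x $ i) = M i) :: real)"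
    proof (cases "\<forall>i\<in>I. lead (c i) (x $ i) = M i")
      case False
      then show ?thesis by (auto intro!: prod_zero)
    qed simp
    finally show ?thesis .
  qed
  have L: "(\<Prod>i\<in>I. len_coeff s (a i)) = \<sigma> * (1 / 2 ^ (\<Sum>i\<in>UNIV. c i))"
  proof -
    have "len_coeff s (a i) = (if a i = 0 then 1 else -1) * (1 / 2 ^ c i)" if "i \<in> I" for i
    proof (cases "a i = 0")
      case False
      then have "s = c i + (a i - 1)" using as[of i] that by (auto simp: c_def)
      then have "(2::real) ^ s = 2 ^ c i * 2 ^ (a i - 1)" by (metis power_add)
      with False show ?thesis by (simp add: len_coeff_def)
    qed (simp add: len_coeff_def c_def)
    then have "(\<Prod>i\<in>I. len_coeff s (a i)) = (\<Prod>i\<in>I. (if a i = 0 then 1 else -1) * (1 / 2 ^ c i))"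
      by (intro prod.cong) auto
    also have "\<dots> = \<sigma> * (1 / 2 ^ (\<Sum>i\<in>I. c i))"
      by (simp only: prod.distrib \<sigma>_def prod_dividef prod.neutral_const power_sum)
    finally have "(\<Prod>i\<in>I. len_coeff s (a i)) = \<sigma> * (1 / 2 ^ (\<Sum>i\<in>I. c i))" .
    moreover have "(\<Sum>i\<in>UNIV. c i) = (\<Sum>i\<in>I. c i)"
      by (subst sum.remove[of UNIV j]) (auto simp: c_def)
    ultimately show ?thesis by simp
  qed
  let ?b = "\<lambda>x. dyadic_add (x $ j) (real (v XOR \<zeta> j) / 2 ^ s) < y"
  let ?R = "{x \<in> D. (\<forall>i\<in>I. lead (c i) (x $ i) = M i) \<and> ?b x}"
  have "(\<Sum>x\<in>D. of_bool (?b x) * (\<Prod>i\<in>I. ind_coeff (a i) (lead s (x $ i)) (\<zeta> i)))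
     = (\<Sum>x\<in>D. \<sigma> * of_bool ((\<forall>i\<in>I. lead (c i) (x $ i) = M i) \<and> ?b x))"
    by (intro sum.cong refl) (simp add: K)
  also have "\<dots> = \<sigma> * real (card ?R)"
    using net_facts(1) by (simp add: sum_distrib_left[symmetric] Int_def)
  finally have "coeff v \<zeta> a = \<sigma> * (real (card ?R) - 2 ^ s * y / 2 ^ (\<Sum>i\<in>UNIV. c i))"
    unfolding coeff_def L y_def[symmetric] by (simp add: algebra_simps)
  then have "\<bar>coeff v \<zeta> a\<bar> = \<bar>real (card ?R) - 2 ^ s * y / 2 ^ (\<Sum>i\<in>UNIV. c i)\<bar>"
    using \<sigma> by (simp add: abs_mult)
  also have "\<dots> \<le> 2 ^ \<delta>"
  proof (rule dyadic_net_column_disc[OF net M])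
    show "v XOR \<zeta> j < 2 ^ s" using v P_less[OF z] by (rule xor_less)
    show "0 \<le> y" "y < 1" using offset_bounds[of j] scaled_less_1[OF offset_bounds(2)[of j] v] by (auto simp: y_def)
  qed (simp add: c_def)
  finally show ?thesis .
qed

text \<open>For each value \<open>v\<close> of \<open>m j\<close> the main term is a chaos in the
  other entries with coefficients bounded by \<open>2 ^ \<delta>\<close>, so domination and the
  one-dimensional moment bound apply.\<close>

lemma sum_main_term_power_le:
  assumes z: "\<zeta> \<in> P"
  shows "(\<Sum>m\<in>P. main_term m \<zeta> ^ (2 * p))
     \<le> 2 ^ (s * CARD('n)) * ((2 ^ \<delta> / 2 ^ card I) ^ (2 * p) * (real p * (real s + 1)) ^ (p * card I))"
proof -
  let ?Q = "I \<rightarrow>\<^sub>E {..<(2::nat) ^ s}"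
  have UN: "UNIV = insert j I" by auto
  have fQ: "(\<Sum>m\<in>P. F m) = (\<Sum>v<2 ^ s. \<Sum>g\<in>?Q. F (g(j := v)))" for F :: "('n \<Rightarrow> nat) \<Rightarrow> real"
  proof -
    have "P = (\<lambda>(v, g). g(j := v)) ` ({..<2 ^ s} \<times> ?Q)"
      by (subst UN, subst PiE_insert_eq) simp
    moreover have "inj_on (\<lambda>(v, g). g(j := v)) ({..<2 ^ s} \<times> ?Q)"
      by (rule inj_combinator) simp
    ultimately show ?thesis
      by (simp add: sum.reindex sum.cartesian_product case_prod_unfold)
  qed
  have UP: "g(j := v) \<in> P" if "g \<in> ?Q" "v < 2 ^ s" for g v
    using that by (auto simp: PiE_iff)
  have "(\<Sum>m\<in>P. main_term m \<zeta> ^ (2 * p)) = (\<Sum>v<2 ^ s. \<Sum>g\<in>?Q.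
     ((\<Sum>a\<in>I \<rightarrow>\<^sub>E {..s}. coeff v \<zeta> a * (\<Prod>i\<in>I. rad (a i) (g i))) / 2 ^ card I) ^ (2 * p))"
    unfolding fQ by (intro sum.cong refl) (simp add: main_term_eq_sum[OF UP z])
  also have "\<dots> = (\<Sum>v<2 ^ s. (\<Sum>g\<in>?Q.
     (\<Sum>a\<in>I \<rightarrow>\<^sub>E {..s}. coeff v \<zeta> a * (\<Prod>i\<in>I. rad (a i) (g i))) ^ (2 * p)) / (2 ^ card I) ^ (2 * p))"
    by (simp only: power_divide flip: sum_divide_distrib)
  also have "\<dots> \<le> (\<Sum>v<(2::nat) ^ s. ((2 ^ \<delta>) ^ (2 * p) * (2 ^ s * (real p * (real s + 1)) ^ p) ^ card I)
      / (2 ^ card I) ^ (2 * p))"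
  proof (intro sum_mono divide_right_mono)
    fix v assume "v \<in> {..<(2::nat) ^ s}"
    then have "\<And>a. a \<in> I \<rightarrow>\<^sub>E {..s} \<Longrightarrow> \<bar>coeff v \<zeta> a\<bar> \<le> 2 ^ \<delta>" by (intro coeff_le z) auto
    from rad_chaos_domination[where I = I and A = "coeff v \<zeta>" and n = "2 * p", OF _ this]
    have "(\<Sum>g\<in>?Q. (\<Sum>a\<in>I \<rightarrow>\<^sub>E {..s}. coeff v \<zeta> a * (\<Prod>i\<in>I. rad (a i) (g i))) ^ (2 * p))
      \<le> (2 ^ \<delta>) ^ (2 * p) * (\<Sum>v<2 ^ s. (\<Sum>a\<le>s. rad a v) ^ (2 * p)) ^ card I" by simp
    also have "\<dots> \<le> (2 ^ \<delta>) ^ (2 * p) * (2 ^ s * (real p * (real s + 1)) ^ p) ^ card I"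
      by (intro mult_left_mono power_mono sum_rad_even_moment_le sum_nonneg) auto
    finally show "(\<Sum>g\<in>?Q. (\<Sum>a\<in>I \<rightarrow>\<^sub>E {..s}. coeff v \<zeta> a * (\<Prod>i\<in>I. rad (a i) (g i))) ^ (2 * p))
      \<le> (2 ^ \<delta>) ^ (2 * p) * (2 ^ s * (real p * (real s + 1)) ^ p) ^ card I" .
  qed simp
  also have "\<dots> = (2 ^ s * (2 ^ s) ^ card I) * ((2 ^ \<delta> / 2 ^ card I) ^ (2 * p) * (real p * (real s + 1)) ^ (p * card I))"
    by (simp add: power_mult_distrib power_divide power_mult)
  also have "2 ^ s * (2 ^ s) ^ card I = (2::real) ^ (s * CARD('n))"
  proof -
    have C: "CARD('n) = Suc (card I)" by (metis card_Suc_Diff1 finite UNIV_I)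
    show ?thesis unfolding C power_mult power_Suc ..
  qed
  finally show ?thesis .
qed

end

section \<open>Averaging over shifts\<close>

text \<open>Minkowski's inequality with a constant, and the monotonicity of power means, both read off
  from pointwise convexity estimates at the expected bound \<open>u + c\<close>.\<close>

lemma powr_le_convex_comb:
  fixes x F u c q :: real and p :: nat
  assumes u: "0 < u" and c: "0 \<le> c" and q: "0 < q" "q \<le> 2 * real p" and x: "0 \<le> x" "x \<le> \<bar>F\<bar> + c"
  defines "\<theta> \<equiv> q / (2 * real p)" and "l \<equiv> u / (u + c)"
  shows "x powr q \<le> (u + c) powr q * (\<theta> * (l * (F / u) ^ (2 * p) + (1 - l)) + (1 - \<theta>))"
proof -
  define y where "y = x / (u + c)"
  have K: "0 < u + c" using u c by simp
  have y0: "0 \<le> y" using x K by (simp add: y_def)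
  have p0: "0 < real p" using q by simp
  have \<theta>: "0 \<le> \<theta>" "0 \<le> 1 - \<theta>" using q p0 by (auto simp: \<theta>_def)
  have l: "0 \<le> l" "l \<le> 1" using u c by (auto simp: l_def)
  have "y \<le> (\<bar>F\<bar> + c) / (u + c)" unfolding y_def using x K by (intro divide_right_mono) auto
  \<comment> \<open>A convex combination of 1 and \<open>\<bar>F\<bar> / u\<close>, with weights
    \<open>c / (u + c)\<close> and \<open>u / (u + c)\<close>.\<close>
  also have "\<dots> = (1 - l) * 1 + l * (\<bar>F\<bar> / u)"
  proof -
    have "1 - l = c / (u + c)" using K by (simp add: l_def diff_divide_eq_iff)
    then show ?thesis using u by (simp add: l_def add_divide_distrib)
  qed
  finally have "y ^ (2 * p) \<le> ((1 - l) * 1 + l * (\<bar>F\<bar> / u)) ^ (2 * p)"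
    by (rule power_mono[OF _ y0])
  also have "\<dots> \<le> (1 - l) * 1 ^ (2 * p) + l * (\<bar>F\<bar> / u) ^ (2 * p)"
    using convex_onD[OF convex_power_even[of "2 * p"], of l 1 "\<bar>F\<bar> / u"] l by simp
  also have "(\<bar>F\<bar> / u) ^ (2 * p) = (F / u) ^ (2 * p)"
    by (simp add: power_divide power_even_abs)
  finally have y2: "y ^ (2 * p) \<le> l * (F / u) ^ (2 * p) + (1 - l)" by simp
  have "y powr q \<le> \<theta> * y ^ (2 * p) + (1 - \<theta>)"
  proof (cases "y = 0")
    case True
    then show ?thesis using \<theta> p0 q by simp
  next
    case False
    then have y: "0 < y" using y0 by simp
    \<comment> \<open>Young's inequality against the constant 1 puts the concave power
      \<open>\<theta>\<close> below its tangent at 1.\<close>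
    have "y powr q = (y ^ (2 * p)) powr \<theta> * 1 powr (1 - \<theta>)"
      using y p0 by (simp add: \<theta>_def powr_powr flip: powr_realpow)
    also have "\<dots> \<le> \<theta> * y ^ (2 * p) + (1 - \<theta>) * 1"
      using \<theta> y by (intro Youngs_inequality_0) auto
    finally show ?thesis by simp
  qed
  also have "\<dots> \<le> \<theta> * (l * (F / u) ^ (2 * p) + (1 - l)) + (1 - \<theta>)"
    using mult_left_mono[OF y2 \<theta>(1)] by simp
  finally have "(u + c) powr q * y powr q \<le> (u + c) powr q * (\<theta> * (l * (F / u) ^ (2 * p) + (1 - l)) + (1 - \<theta>))"
    by (rule mult_left_mono) simp
  moreover have "(u + c) powr q * y powr q = x powr q"
    using K x y0 by (simp add: y_def flip: powr_mult)
  ultimately show ?thesis by simp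
qed

lemma sum_powr_le:
  fixes x F :: "'a \<Rightarrow> real" and u c q :: real and p :: nat
  assumes u: "0 < u" and c: "0 \<le> c" and q: "0 < q" "q \<le> 2 * real p"
    and x: "\<And>m. m \<in> S \<Longrightarrow> 0 \<le> x m" "\<And>m. m \<in> S \<Longrightarrow> x m \<le> \<bar>F m\<bar> + c"
    and F: "(\<Sum>m\<in>S. F m ^ (2 * p)) \<le> real (card S) * u ^ (2 * p)"
  shows "(\<Sum>m\<in>S. x m powr q) \<le> real (card S) * (u + c) powr q"
proof -
  define \<theta> l N where "\<theta> = q / (2 * real p)" and "l = u / (u + c)" and "N = real (card S)"
  have "0 \<le> \<theta>" "0 \<le> l" "0 \<le> N" using u c q by (auto simp: \<theta>_def l_def N_def)
  have "(\<Sum>m\<in>S. (F m / u) ^ (2 * p)) \<le> N"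
    using F u by (simp add: power_divide divide_le_eq N_def flip: sum_divide_distrib)
  then have "\<theta> * (l * (\<Sum>m\<in>S. (F m / u) ^ (2 * p)) + N * (1 - l)) + N * (1 - \<theta>)
     \<le> \<theta> * (l * N + N * (1 - l)) + N * (1 - \<theta>)"
    using \<open>0 \<le> \<theta>\<close> \<open>0 \<le> l\<close> \<open>0 \<le> N\<close> by (intro add_mono mult_left_mono) auto
  also have "\<dots> = N" by (simp add: algebra_simps)
  finally have N: "\<theta> * (l * (\<Sum>m\<in>S. (F m / u) ^ (2 * p)) + N * (1 - l)) + N * (1 - \<theta>) \<le> N" .
  have "(\<Sum>m\<in>S. x m powr q)
     \<le> (\<Sum>m\<in>S. (u + c) powr q * (\<theta> * (l * (F m / u) ^ (2 * p) + (1 - l)) + (1 - \<theta>)))"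
    unfolding \<theta>_def l_def by (intro sum_mono powr_le_convex_comb u c q x)
  also have "\<dots> = (u + c) powr q * (\<theta> * (l * (\<Sum>m\<in>S. (F m / u) ^ (2 * p)) + N * (1 - l)) + N * (1 - \<theta>))"
    by (simp only: sum_distrib_left[symmetric] sum.distrib sum_constant N_def)
  also have "\<dots> \<le> (u + c) powr q * N"
    using N by (rule mult_left_mono) simp
  finally show ?thesis by (simp add: N_def mult.commute)
qed

text \<open>\<open>u\<close> is the \<open>2 * p\<close>-th root of the averaged moment bound for
  the main term; the uniform error enters as the constant in \<open>sum_powr_le\<close>.\<close>

lemma (in shifted_net) sum_local_disc_le:
  assumes z: "\<zeta> \<in> P" and q: "0 < q" "q \<le> 2 * real p"
  defines "u \<equiv> 2 ^ \<delta> / 2 ^ (CARD('n) - 1) * (real p * (real s + 1)) powr ((real CARD('n) - 1) / 2)"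
  shows "(\<Sum>m\<in>P. \<bar>local_disc (dyadic_shift D (shift_point s (\<lambda>i. m i XOR \<zeta> i))) (cell_point s m W)\<bar> powr q)
    \<le> 2 ^ (s * CARD('n)) * (u + (real CARD('n) - 1) * 2 ^ \<delta>) powr q"
proof -
  define B where "B = real p * (real s + 1)"
  have B: "0 < B" using q by (auto simp: B_def)
  have cI: "card I = CARD('n) - 1" by simp
  have rI: "real (card I) = real CARD('n) - 1" by (simp add: cI of_nat_diff)
  have cP: "real (card P) = 2 ^ (s * CARD('n))"
    by (simp add: card_PiE power_mult)
  have "u ^ (2 * p) = (2 ^ \<delta> / 2 ^ card I) ^ (2 * p) * (B powr (real (card I) / 2)) ^ (2 * p)"
    unfolding u_def B_def rI unfolding cI by (rule power_mult_distrib)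
  also have "(B powr (real (card I) / 2)) ^ (2 * p) = B ^ (p * card I)"
    using B by (simp add: powr_realpow[symmetric] powr_powr mult.commute)
  finally have u2: "u ^ (2 * p) = (2 ^ \<delta> / 2 ^ card I) ^ (2 * p) * B ^ (p * card I)" .
  have "(\<Sum>m\<in>P. \<bar>local_disc (dyadic_shift D (shift_point s (\<lambda>i. m i XOR \<zeta> i))) (cell_point s m W)\<bar> powr q)
    \<le> real (card P) * (u + (real CARD('n) - 1) * 2 ^ \<delta>) powr q"
  proof (rule sum_powr_le[where p = p and F = "\<lambda>m. main_term m \<zeta>"])
    have "0 < B powr ((real CARD('n) - 1) / 2)" using B by simp
    then show "0 < u" unfolding u_def B_def by (intro mult_pos_pos divide_pos_pos) auto
    show "0 \<le> (real CARD('n) - 1) * 2 ^ \<delta>" unfolding rI[symmetric] by simp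
    show "(\<Sum>m\<in>P. main_term m \<zeta> ^ (2 * p)) \<le> real (card P) * u ^ (2 * p)"
      using sum_main_term_power_le[OF z, of p] unfolding cP u2 B_def .
    fix m assume m: "m \<in> P"
    show "\<bar>local_disc (dyadic_shift D (shift_point s (\<lambda>i. m i XOR \<zeta> i))) (cell_point s m W)\<bar>
      \<le> \<bar>main_term m \<zeta>\<bar> + (real CARD('n) - 1) * 2 ^ \<delta>"
      using main_term_error[OF m z] unfolding local_disc_eq[OF m z] by linarith
  qed (use q in auto)
  then show ?thesis unfolding cP .
qed

section \<open>Integration over the unit cube by cells\<close>

lemma cell_borel [measurable]: "(cell s :: (real ^ 'n) set) \<in> sets borel"
  unfolding cell_def by (rule half_open_box_borel)

lemma measure_cell:
  "(cell s :: (real ^ 'n) set) \<in> fmeasurable lborel"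
  "measure lborel (cell s :: (real ^ 'n) set) = 1 / 2 ^ (s * CARD('n))"
  using measure_half_open_box[of "\<lambda>_ :: 'n. 0" "\<lambda>_. 1 / 2 ^ s"]
  by (simp_all add: cell_def power_mult power_one_over)

lemma unit_cube_borel [measurable]: "(unit_cube :: (real ^ 'n) set) \<in> sets borel"
  unfolding unit_cube_def by (rule half_open_box_borel)

lemma unit_cube_fmeasurable: "(unit_cube :: (real ^ 'n) set) \<in> fmeasurable lborel"
  using measure_half_open_box(1)[of "\<lambda>_ :: 'n. 0" "\<lambda>_. 1"] by (simp add: unit_cube_def)

lemma cell_point_in_unit_cube:
  assumes "m \<in> UNIV \<rightarrow>\<^sub>E {..<(2::nat) ^ s}" "W \<in> cell s"
  shows "cell_point s m W \<in> unit_cube"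
proof -
  have "0 \<le> real (m i) / 2 ^ s + W $ i \<and> real (m i) / 2 ^ s + W $ i < 1" for i
  proof -
    have W: "0 \<le> W $ i" "2 ^ s * W $ i < 1" using assms(2) by (auto simp: cell_def field_simps)
    have "m i < 2 ^ s" using assms(1) by (auto simp: PiE_iff)
    from scaled_less_1[OF W(2) this] W(1) show ?thesis by (simp add: add_divide_distrib)
  qed
  then show ?thesis by (simp add: unit_cube_def cell_point_def)
qed

text \<open>The cube is a disjoint union of translates of \<open>cell s\<close>, and Lebesgue
  measure is translation invariant. The common offset can thus be integrated last.\<close>

lemma set_integral_unit_cube_eq_sum_cells:
  fixes f :: "real ^ 'n \<Rightarrow> real"
  assumes int: "set_integrable lborel unit_cube f" and [measurable]: "f \<in> borel_measurable borel"
  shows "(LINT Y:unit_cube|lborel. f Y)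
    = (\<Sum>m\<in>UNIV \<rightarrow>\<^sub>E {..<(2::nat) ^ s}. LINT W:cell s|lborel. f (cell_point s m W))"
proof -
  let ?P = "UNIV \<rightarrow>\<^sub>E {..<(2::nat) ^ s} :: ('n \<Rightarrow> nat) set"
  define A where "A m = {X :: real ^ 'n. \<forall>i. real (m i) / 2 ^ s \<le> X $ i \<and> X $ i < (real (m i) + 1) / 2 ^ s}"
    for m :: "'n \<Rightarrow> nat"
  have [measurable]: "A m \<in> sets borel" for m unfolding A_def by (rule half_open_box_borel)
  have A_lead: "X \<in> A m \<longleftrightarrow> (\<forall>i. 0 \<le> X $ i \<and> lead s (X $ i) = m i)" for X m
  proof -
    have "0 \<le> X $ i" if "real (m i) / 2 ^ s \<le> X $ i" for i
      by (rule order_trans[OF _ that]) simp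
    then show ?thesis unfolding A_def using lead_eq_iff by blast
  qed
  have cube: "unit_cube = (\<Union>m\<in>?P. A m)"
  proof (intro equalityI subsetI)
    fix X :: "real ^ 'n" assume X: "X \<in> unit_cube"
    then have "X \<in> A (\<lambda>i. lead s (X $ i))" by (simp add: A_lead unit_cube_def)
    moreover have "(\<lambda>i. lead s (X $ i)) \<in> ?P"
      using X lead_less by (auto simp: PiE_iff unit_cube_def)
    ultimately show "X \<in> (\<Union>m\<in>?P. A m)" by blast
  next
    fix X :: "real ^ 'n" assume "X \<in> (\<Union>m\<in>?P. A m)"
    then obtain m where m: "m \<in> ?P" "X \<in> A m" by blast
    have "X $ i < 1" for i
    proof -
      have 0: "0 \<le> X $ i" "lead s (X $ i) = m i" using m(2) by (auto simp: A_lead)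
      have "m i < 2 ^ s" using m(1) by (auto simp: PiE_iff)
      moreover have "2 ^ s * X $ i - real (m i) < 1" using lead_bounds(2)[OF 0(1), of s] 0(2) by simp
      ultimately show ?thesis using scaled_less_1[of "2 ^ s * X $ i - real (m i)" "m i" s] by simp
    qed
    then show "X \<in> unit_cube" using m(2) by (simp add: A_lead unit_cube_def)
  qed
  have disj: "disjoint_family_on A ?P"
    unfolding disjoint_family_on_def
  proof (intro ballI impI)
    fix m n :: "'n \<Rightarrow> nat" assume "m \<noteq> n"
    then show "A m \<inter> A n = {}" by (auto simp: A_lead fun_eq_iff)
  qed
  have "(LINT Y:unit_cube|lborel. f Y) = (\<Sum>m\<in>?P. LINT Y:A m|lborel. f Y)"
    unfolding cube
  proof (rule set_integral_finite_Union[OF _ disj])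
    show "finite ?P" by (intro finite_PiE) auto
    show "set_integrable lborel (A m) f" if "m \<in> ?P" for m
      by (rule set_integrable_subset[OF int]) (use that cube in auto)
  qed simp
  also have "\<dots> = (\<Sum>m\<in>?P. LINT W:cell s|lborel. f (cell_point s m W))"
  proof (intro sum.cong refl)
    fix m assume "m \<in> ?P"
    let ?c = "shift_point s m :: real ^ 'n"
    have cp: "?c + W = cell_point s m W" for W
      by (simp add: vec_eq_iff cell_point_def shift_point_def)
    have "(LINT Y:A m|lborel. f Y) = (LINT Y|distr lborel borel ((+) ?c). indicator (A m) Y *\<^sub>R f Y)"
      by (simp add: lborel_distr_plus set_lebesgue_integral_def)
    also have "\<dots> = (LINT W|lborel. indicator (A m) (?c + W) *\<^sub>R f (?c + W))"
      by (rule integral_distr) measurable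
    also have "\<dots> = (LINT W:cell s|lborel. f (cell_point s m W))"
      unfolding set_lebesgue_integral_def cp
    proof (intro Bochner_Integration.integral_cong refl)
      fix W :: "real ^ 'n"
      have "cell_point s m W \<in> A m \<longleftrightarrow> W \<in> cell s"
        by (simp add: A_def cell_def cell_point_def add_divide_distrib)
      then show "indicator (A m) (cell_point s m W) *\<^sub>R f (cell_point s m W)
        = indicator (cell s) W *\<^sub>R f (cell_point s m W)" by (simp add: indicator_def)
    qed
    finally show "(LINT Y:A m|lborel. f Y) = (LINT W:cell s|lborel. f (cell_point s m W))" .
  qed
  finally show ?thesis .
qed

lemma local_disc_measurable [measurable]:
  assumes "finite D"
  shows "local_disc (D :: (real ^ 'n) set) \<in> borel_measurable borel"
proof -
  have "real (card (D \<inter> anchored_box Y)) = (\<Sum>x\<in>D. of_bool (\<forall>i. 0 \<le> x $ i \<and> x $ i < Y $ i))" for Y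
    using assms by (simp add: anchored_box_def Int_def)
  then have "local_disc D = (\<lambda>Y. (\<Sum>x\<in>D. of_bool (\<forall>i. 0 \<le> x $ i \<and> x $ i < Y $ i)) - real (card D) * (\<Prod>i\<in>UNIV. Y $ i))"
    by (simp add: local_disc_def fun_eq_iff)
  moreover have "(\<lambda>Y. (\<Sum>x\<in>D. of_bool (\<forall>i. 0 \<le> x $ i \<and> x $ i < Y $ i)) - real (card D) * (\<Prod>i\<in>UNIV. Y $ i))
     \<in> borel_measurable (borel :: (real ^ 'n) measure)"
    unfolding of_bool_def by measurable
  ultimately show ?thesis by simp
qed

text \<open>Count and expected count both lie between 0 and \<open>card D\<close>. This supplies
  integrability.\<close>

lemma abs_local_disc_le:
  assumes "finite D" "Y \<in> unit_cube"
  shows "\<bar>local_disc D Y\<bar> \<le> real (card D)"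
proof -
  have Y: "0 \<le> Y $ i" "Y $ i \<le> 1" for i using assms(2) by (auto simp: unit_cube_def less_imp_le)
  have "0 \<le> (\<Prod>i\<in>UNIV. Y $ i)" "(\<Prod>i\<in>UNIV. Y $ i) \<le> 1"
    using Y by (auto intro: prod_nonneg prod_le_1)
  then have "0 \<le> real (card D) * (\<Prod>i\<in>UNIV. Y $ i)" "real (card D) * (\<Prod>i\<in>UNIV. Y $ i) \<le> real (card D)"
    by (auto intro: mult_left_le)
  moreover have "real (card (D \<inter> anchored_box Y)) \<le> real (card D)"
    using assms(1) by (intro of_nat_mono card_mono) auto
  ultimately show ?thesis unfolding local_disc_def by linarith
qed

lemma Lq_disc_powr:
  assumes "0 < q"
  shows "Lq_disc q D powr q = (LINT Y:unit_cube|lborel. \<bar>local_disc D Y\<bar> powr q)"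
proof -
  have "0 \<le> (LINT Y:unit_cube|lborel. \<bar>local_disc D Y\<bar> powr q)"
    unfolding set_lebesgue_integral_def by (intro Bochner_Integration.integral_nonneg) simp
  then show ?thesis using assms by (simp add: Lq_disc_def powr_powr)
qed

section \<open>The mean over all shifts\<close>

lemma dyadic_shifts_eq: "dyadic_shifts s = shift_point s ` (UNIV \<rightarrow>\<^sub>E {..<(2::nat) ^ s})"
proof (intro equalityI subsetI)
  fix T :: "real ^ 'n" assume "T \<in> dyadic_shifts s"
  then have "\<forall>i. \<exists>m. T $ i = real m / 2 ^ s \<and> m < 2 ^ s"
    by (auto simp: dyadic_shifts_def dyadic_rats_def)
  then obtain m where "\<And>i. T $ i = real (m i) / 2 ^ s \<and> m i < 2 ^ s" by metis
  then have "T = shift_point s m" "m \<in> UNIV \<rightarrow>\<^sub>E {..<(2::nat) ^ s}"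
    by (auto simp: shift_point_def vec_eq_iff)
  then show "T \<in> shift_point s ` (UNIV \<rightarrow>\<^sub>E {..<(2::nat) ^ s})" by blast
qed (auto simp: dyadic_shifts_def dyadic_rats_def shift_point_def PiE_iff)

lemma inj_shift_point: "inj (shift_point s)"
  by (rule injI) (simp add: shift_point_def vec_eq_iff fun_eq_iff)

text \<open>\<open>XOR\<close> with a fixed \<open>m\<close> is an involution of the index set. It
  allows the shift to be tied to the cell index.\<close>

lemma sum_xor_reindex:
  fixes F :: "('n \<Rightarrow> nat) \<Rightarrow> 'a :: comm_monoid_add"
  assumes m: "m \<in> UNIV \<rightarrow>\<^sub>E {..<(2::nat) ^ s}"
  shows "(\<Sum>\<tau>\<in>UNIV \<rightarrow>\<^sub>E {..<(2::nat) ^ s}. F \<tau>) = (\<Sum>\<zeta>\<in>UNIV \<rightarrow>\<^sub>E {..<(2::nat) ^ s}. F (\<lambda>i. m i XOR \<zeta> i))"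
proof -
  let ?g = "\<lambda>\<tau> i. m i XOR \<tau> i"
  have inv: "?g (?g \<tau>) = \<tau>" for \<tau> by (simp add: fun_eq_iff xor.assoc[symmetric])
  have cl: "?g \<tau> \<in> UNIV \<rightarrow>\<^sub>E {..<(2::nat) ^ s}" if "\<tau> \<in> UNIV \<rightarrow>\<^sub>E {..<(2::nat) ^ s}" for \<tau>
    using m that xor_less[where s = s] by (auto simp: PiE_iff)
  show ?thesis
    by (rule sum.reindex_bij_witness[of _ ?g ?g]) (simp_all only: inv cl)
qed

text \<open>At a fixed offset the substitution \<open>\<tau> = m XOR \<zeta>\<close> makes the inner
  sum run over \<open>m\<close> at fixed \<open>\<zeta>\<close>, where the chaos bound holds; the
  offset is then integrated over one cell.\<close>

lemma mean_disc_le: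
  fixes D :: "(real ^ 'n) set"
  assumes net: "dyadic_net \<delta> s D" and q: "0 < q" "q \<le> 2 * real p"
  shows "mean_disc s q D \<le> 2 ^ \<delta> / 2 ^ (CARD('n) - 1) * (real p * (real s + 1)) powr ((real CARD('n) - 1) / 2)
    + (real CARD('n) - 1) * 2 ^ \<delta>"
proof -
  let ?P = "UNIV \<rightarrow>\<^sub>E {..<(2::nat) ^ s} :: ('n \<Rightarrow> nat) set"
  let ?N = "2 ^ (s * CARD('n)) :: real"
  define K where "K = 2 ^ \<delta> / 2 ^ (CARD('n) - 1) * (real p * (real s + 1)) powr ((real CARD('n) - 1) / 2)
    + (real CARD('n) - 1) * 2 ^ \<delta>"
  define S where "S \<tau> = dyadic_shift D (shift_point s \<tau>)" for \<tau> :: "'n \<Rightarrow> nat"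
  define g where "g \<tau> Y = \<bar>local_disc (S \<tau>) Y\<bar> powr q" for \<tau> Y
  have "1 \<le> real CARD('n)" by (simp add: Suc_le_eq)
  then have K0: "0 \<le> K" by (simp add: K_def)
  have fS: "finite (S \<tau>)" for \<tau> using net by (auto simp: S_def dyadic_shift_def dyadic_net_def)
  have [measurable]: "g \<tau> \<in> borel_measurable borel" for \<tau>
    unfolding g_def using local_disc_measurable[OF fS, of \<tau>] by measurable
  have gle: "norm (g \<tau> Y) \<le> real (card (S \<tau>)) powr q" if "Y \<in> unit_cube" for \<tau> Y
    using abs_local_disc_le[OF fS that] q(1) by (simp add: g_def powr_mono2)
  have cp [measurable]: "cell_point s m \<in> borel_measurable borel" for m :: "'n \<Rightarrow> nat"
  proof -
    have "cell_point s m = (\<lambda>W. shift_point s m + W)"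
      by (simp add: fun_eq_iff vec_eq_iff cell_point_def shift_point_def)
    then show ?thesis by simp
  qed
  have int: "set_integrable lborel unit_cube (g \<tau>)" for \<tau>
    unfolding set_integrable_def
    using fmeasurableD2[OF unit_cube_fmeasurable] gle
    by (intro integrableI_bounded_set_indicator[where B = "real (card (S \<tau>)) powr q"])
      (auto simp: top.not_eq_extremum)
  have intc: "set_integrable lborel (cell s) (\<lambda>W. g \<tau> (cell_point s m W))" if "m \<in> ?P" for m \<tau>
    unfolding set_integrable_def
    using fmeasurableD2[OF measure_cell(1)[of s, where 'n = 'n]] gle[OF cell_point_in_unit_cube[OF that]]
    by (intro integrableI_bounded_set_indicator[where B = "real (card (S \<tau>)) powr q"])
      (auto simp: top.not_eq_extremum)
  have fin: "finite ?P" by (intro finite_PiE) auto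
  have cP: "real (card ?P) = ?N" by (simp add: card_PiE power_mult)
  \<comment> \<open>Any coordinate can serve as the unexpanded one.\<close>
  obtain j :: 'n where True by simp
  have point: "(\<Sum>\<tau>\<in>?P. \<Sum>m\<in>?P. g \<tau> (cell_point s m W)) \<le> ?N * (?N * K powr q)" if W: "W \<in> cell s" for W
  proof -
    interpret shifted_net D \<delta> s j W by standard (use net W in auto)
    have "(\<Sum>\<tau>\<in>?P. \<Sum>m\<in>?P. g \<tau> (cell_point s m W)) = (\<Sum>m\<in>?P. \<Sum>\<tau>\<in>?P. g \<tau> (cell_point s m W))"
      by (rule sum.swap)
    also have "\<dots> = (\<Sum>m\<in>?P. \<Sum>\<zeta>\<in>?P. g (\<lambda>i. m i XOR \<zeta> i) (cell_point s m W))"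
      by (intro sum.cong refl sum_xor_reindex)
    also have "\<dots> = (\<Sum>\<zeta>\<in>?P. \<Sum>m\<in>?P. g (\<lambda>i. m i XOR \<zeta> i) (cell_point s m W))"
      by (rule sum.swap)
    also have "\<dots> \<le> (\<Sum>\<zeta>\<in>?P. ?N * K powr q)"
      unfolding g_def S_def K_def by (intro sum_mono sum_local_disc_le q)
    also have "\<dots> = ?N * (?N * K powr q)" unfolding sum_constant cP ..
    finally show ?thesis .
  qed
  have intsum: "set_integrable lborel (cell s) (\<lambda>W. \<Sum>\<tau>\<in>?P. \<Sum>m\<in>?P. g \<tau> (cell_point s m W))"
    using intc unfolding set_integrable_def scaleR_sum_right
    by (intro Bochner_Integration.integrable_sum) auto
  have intconst: "set_integrable lborel (cell s :: (real ^ 'n) set) (\<lambda>_. ?N * (?N * K powr q))"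
    using fmeasurableD2[OF measure_cell(1)[of s, where 'n = 'n]]
    by (simp add: set_integrable_def top.not_eq_extremum)
  have "(\<Sum>T\<in>dyadic_shifts s. Lq_disc q (dyadic_shift D T) powr q) = (\<Sum>\<tau>\<in>?P. LINT Y:unit_cube|lborel. g \<tau> Y)"
    unfolding dyadic_shifts_eq
    by (subst sum.reindex) (auto simp: Lq_disc_powr[OF q(1)] g_def[abs_def] S_def intro: inj_on_subset[OF inj_shift_point])
  also have "\<dots> = (\<Sum>\<tau>\<in>?P. \<Sum>m\<in>?P. LINT W:cell s|lborel. g \<tau> (cell_point s m W))"
    by (intro sum.cong refl set_integral_unit_cube_eq_sum_cells int) measurable
  also have "\<dots> = (LINT W:cell s|lborel. \<Sum>\<tau>\<in>?P. \<Sum>m\<in>?P. g \<tau> (cell_point s m W))"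
    using intc unfolding set_integrable_def set_lebesgue_integral_def scaleR_sum_right
    by (subst Bochner_Integration.integral_sum) (auto intro!: sum.cong Bochner_Integration.integral_sum[symmetric])
  also have "\<dots> \<le> (LINT W:(cell s :: (real ^ 'n) set)|lborel. ?N * (?N * K powr q))"
    by (rule set_integral_mono[OF intsum intconst point])
  \<comment> \<open>The cell has measure \<open>1 / ?N\<close>, which removes one factor
    \<open>?N\<close>; the other is absorbed by the normalisation of the mean.\<close>
  also have "\<dots> = ?N * K powr q"
    by (subst set_integral_const) (use fmeasurableD2[OF measure_cell(1)] in \<open>auto simp: measure_cell(2)\<close>)
  finally have "(\<Sum>T\<in>dyadic_shifts s. Lq_disc q (dyadic_shift D T) powr q) / 2 ^ (CARD('n) * s) \<le> K powr q"
    by (simp add: divide_le_eq mult.commute)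
  moreover have "0 \<le> (\<Sum>T\<in>dyadic_shifts s. Lq_disc q (dyadic_shift D T) powr q) / 2 ^ (CARD('n) * s)"
    by (intro divide_nonneg_pos sum_nonneg) auto
  ultimately have "mean_disc s q D \<le> (K powr q) powr (1 / q)"
    unfolding mean_disc_def using q(1) by (intro powr_mono2) auto
  also have "\<dots> = K" using K0 q(1) by (simp add: powr_powr)
  finally show ?thesis unfolding K_def .
qed

text \<open>A power mean cannot lie strictly below all of its terms.\<close>

lemma Lq_disc_le_mean_disc:
  fixes D :: "(real ^ 'n) set"
  assumes q: "0 < q"
  shows "\<exists>T\<in>dyadic_shifts s. Lq_disc q (dyadic_shift D T) \<le> mean_disc s q D"
proof (rule ccontr)
  let ?P = "UNIV \<rightarrow>\<^sub>E {..<(2::nat) ^ s} :: ('n \<Rightarrow> nat) set"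
  let ?D = "dyadic_shifts s :: (real ^ 'n) set"
  let ?M = "mean_disc s q D"
  assume "\<not> ?thesis"
  then have less: "?M < Lq_disc q (dyadic_shift D T)" if "T \<in> ?D" for T using that by auto
  have fin: "finite ?D" unfolding dyadic_shifts_eq by (intro finite_imageI finite_PiE) auto
  have card: "real (card ?D) = 2 ^ (CARD('n) * s)"
    unfolding dyadic_shifts_eq by (subst card_image)
      (auto simp: card_PiE power_mult mult.commute intro: inj_on_subset[OF inj_shift_point])
  then have ne: "?D \<noteq> {}" by (metis card.empty of_nat_0 power_not_zero zero_neq_numeral)
  have M0: "0 \<le> ?M" by (simp add: mean_disc_def)
  have "real (card ?D) * ?M powr q = (\<Sum>T\<in>?D. ?M powr q)" by simp
  also have "\<dots> < (\<Sum>T\<in>?D. Lq_disc q (dyadic_shift D T) powr q)"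
    using less M0 q by (intro sum_strict_mono fin ne powr_less_mono2) auto
  also have "\<dots> = 2 ^ (CARD('n) * s) * ?M powr q"
    unfolding mean_disc_def using q by (simp add: powr_powr sum_nonneg)
  finally show False unfolding card by simp
qed

theorem theorem2p1:
  fixes D :: "(real ^ 'n) set" and \<delta> s :: nat and q :: real
  assumes "1 \<le> s" and "\<delta> \<le> s" and "dyadic_net \<delta> s D" and "0 < q"
  shows "mean_disc s q D
           < 2 powi (- int CARD('n) + int \<delta> + 1)
               * (of_int \<lceil>q / 2\<rceil> * (real s + 1)) powr ((real CARD('n) - 1) / 2)
             + real CARD('n) * 2 ^ \<delta>
         \<and> (\<exists>T \<in> dyadic_shifts s. Lq_disc q (dyadic_shift D T)
           \<le> 2 powi (- int CARD('n) + int \<delta> + 1)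
               * (of_int \<lceil>q / 2\<rceil> * (real s + 1)) powr ((real CARD('n) - 1) / 2)
             + real CARD('n) * 2 ^ \<delta>)"
proof -
  \<comment> \<open>The least integer with \<open>q \<le> 2 * real p\<close>, so the moment of order
    \<open>2 * p\<close> controls exponent \<open>q\<close>.\<close>
  define p where "p = nat \<lceil>q / 2\<rceil>"
  have "0 < \<lceil>q / 2\<rceil>" using assms(4) by simp
  then have p: "real p = of_int \<lceil>q / 2\<rceil>" by (simp add: p_def)
  then have qp: "q \<le> 2 * real p" by linarith
  have e: "- int CARD('n) + int \<delta> + 1 = int \<delta> - int (CARD('n) - 1)"
    by (simp add: of_nat_diff)
  have "(2::real) powi (int \<delta> - int k) = 2 ^ \<delta> / 2 ^ k" for k
    by (simp add: power_int_diff)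
  then have "(2::real) powi (- int CARD('n) + int \<delta> + 1) = 2 ^ \<delta> / 2 ^ (CARD('n) - 1)"
    unfolding e .
  then have "mean_disc s q D
      \<le> 2 powi (- int CARD('n) + int \<delta> + 1) * (of_int \<lceil>q / 2\<rceil> * (real s + 1)) powr ((real CARD('n) - 1) / 2)
        + (real CARD('n) - 1) * 2 ^ \<delta>"
    using mean_disc_le[OF assms(3,4) qp] by (simp add: p)
  \<comment> \<open>Strictness comes from enlarging the factor \<open>real CARD('n) - 1\<close> to
    \<open>real CARD('n)\<close>.\<close>
  also have "\<dots> < 2 powi (- int CARD('n) + int \<delta> + 1) * (of_int \<lceil>q / 2\<rceil> * (real s + 1)) powr ((real CARD('n) - 1) / 2)
        + real CARD('n) * 2 ^ \<delta>" by (simp add: algebra_simps)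
  finally show ?thesis using Lq_disc_le_mean_disc[OF assms(4), of s D] by (meson less_imp_le order_trans)
qed

end
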